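(* Let $G$ be a finite solvable group and let $\pi=\pi(G)$ be the set of all primes dividing $|G|$. Then $1 < H_{\pi}(G) < H_{p}(G)$ for all $p \in \pi$ if and only if $G$ is a Frobenius group whose Frobenius kernel $F$ is a nonabelian $q$-group, for some prime $q$, such that $1 < H_{q}(F) < F$, and whose Frobenius complement has prime order. In this case, $H_{\pi}(G) = H_{q}(F)$.
   Context: For a finite group $X$, $\pi(X)$ denotes the set of primes dividing $|X|$. For a prime $r$, the Hughes subgroup of $X$ relative to $r$ is $H_{r}(X) := \langle x \in X : x^{r} \neq 1\rangle$. For a set of primes $\pi$, $H_{\pi}(X) := \langle x \in X : x^{r}\neq 1 \text{ for all } r \in \pi\rangle$. Subgroups generated by the empty set are trivial. The symbol $<$ between subgroups means proper containment, and $1$ denotes the trivial subgroup. *)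

theory Defs
  imports "HOL-Algebra.Solvable_Groups" "HOL-Computational_Algebra.Primes"
begin

(* Qualified, because HOL-Algebra.Divisibility has another constant called prime. *)
definition prime_divisors_group :: "('a, 'b) monoid_scheme \<Rightarrow> nat set" where
  "prime_divisors_group X = {p. Factorial_Ring.prime p \<and> p dvd order X}"

definition hughes :: "('a, 'b) monoid_scheme \<Rightarrow> nat \<Rightarrow> 'a set" where
  "hughes X r = generate X {x \<in> carrier X. x [^]\<^bsub>X\<^esub> r \<noteq> \<one>\<^bsub>X\<^esub>}"

definition hughes_set :: "('a, 'b) monoid_scheme \<Rightarrow> nat set \<Rightarrow> 'a set" where
  "hughes_set X \<pi> = generate X {x \<in> carrier X. \<forall>r\<in>\<pi>. x [^]\<^bsub>X\<^esub> r \<noteq> \<one>\<^bsub>X\<^esub>}"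

(* For prime p this forces X to be finite, since an infinite carrier has order 0. *)
definition finite_p_group :: "nat \<Rightarrow> ('a, 'b) monoid_scheme \<Rightarrow> bool" where
  "finite_p_group p X \<longleftrightarrow> group X \<and> (\<exists>n. order X = p ^ n)"

definition frobenius_complement :: "('a, 'b) monoid_scheme \<Rightarrow> 'a set \<Rightarrow> bool" where
  "frobenius_complement G H \<longleftrightarrow>
     subgroup H G \<and> H \<noteq> {\<one>\<^bsub>G\<^esub>} \<and> H \<noteq> carrier G \<and>
     (\<forall>g \<in> carrier G - H. H \<inter> (g <#\<^bsub>G\<^esub> (H #>\<^bsub>G\<^esub> inv\<^bsub>G\<^esub> g)) = {\<one>\<^bsub>G\<^esub>})"

(* The elements lying in no conjugate of H, together with the identity; that this set is a
   subgroup is a theorem, not part of the definition. *)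
definition frobenius_kernel :: "('a, 'b) monoid_scheme \<Rightarrow> 'a set \<Rightarrow> 'a set" where
  "frobenius_kernel G H =
     (carrier G - (\<Union>g \<in> carrier G. g <#\<^bsub>G\<^esub> (H #>\<^bsub>G\<^esub> inv\<^bsub>G\<^esub> g))) \<union> {\<one>\<^bsub>G\<^esub>}"

definition frobenius_group :: "('a, 'b) monoid_scheme \<Rightarrow> 'a set \<Rightarrow> 'a set \<Rightarrow> bool" where
  "frobenius_group G F H \<longleftrightarrow> frobenius_complement G H \<and> F = frobenius_kernel G H"

end

theory Submission
  imports Defs "HOL-Algebra.Multiplicative_Group" "HOL-Algebra.Sylow" "HOL-Algebra.SndIsomorphismGrp"
begin

text \<open>
  Put \<open>H = H\<^sub>\<pi>(G)\<close>. Every element outside \<open>H\<close> has prime order, and the hypothesis says that at least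
  two primes occur. The key fact is a norm argument: let \<open>U \<le> L < K < G\<close> be normal subgroups with all
  elements outside \<open>L\<close> of prime order and \<open>K / U\<close> a \<open>q\<close>-group, and suppose that some coset \<open>U y\<close> with
  \<open>y \<in> K\<close> consists of elements of order \<open>q\<close>. For \<open>g\<close> outside \<open>K\<close> of order \<open>s\<close>, the identity
  \<open>(g a)\<^sup>s = 1\<close> says that \<open>1 + g + \<dots> + g\<^sup>s\<^sup>-\<^sup>1\<close> annihilates \<open>U / U'\<close>. Summing over a coset of \<open>K\<close> shows
  that a power of \<open>q\<close> annihilates \<open>U / U'\<close>.

  Solvability provides a layer \<open>K / H\<close> of exponent \<open>q\<close>, and descending along the derived series of \<open>H\<close>
  shows that \<open>K\<close> is a \<open>q\<close>-group. Let \<open>F\<close> be a maximal normal \<open>q\<close>-subgroup containing \<open>K\<close> and \<open>M / F\<close> a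
  layer of exponent \<open>p \<noteq> q\<close>. If \<open>M < G\<close>, the key fact with \<open>U = F\<close> would force \<open>F = F'\<close>; hence \<open>M = G\<close>, and
  likewise \<open>F \<langle>x\<rangle> = G\<close> for each \<open>x\<close> outside \<open>F\<close>. Since all elements outside \<open>F\<close> have order \<open>p\<close>, the
  subgroup \<open>\<langle>x\<rangle>\<close> acts fixed-point-freely on \<open>F\<close>, which is the Frobenius structure.
\<close>

subsection \<open>Products over transversals\<close>

lemma (in comm_monoid) finprod_swap:
  assumes "finite I" "finite J" "\<And>i j. i \<in> I \<Longrightarrow> j \<in> J \<Longrightarrow> f i j \<in> carrier G"
  shows "finprod G (\<lambda>i. finprod G (f i) J) I = finprod G (\<lambda>j. finprod G (\<lambda>i. f i j) I) J"
  using assms(1,3)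
proof (induction I rule: finite_induct)
  case (insert i I)
  have "finprod G (\<lambda>j. finprod G (\<lambda>i. f i j) (insert i I)) J = finprod G (\<lambda>j. f i j \<otimes> finprod G (\<lambda>i. f i j) I) J"
    using insert by (intro finprod_cong' refl) (auto simp: Pi_def)
  then show ?case
    using insert by (simp add: Pi_def)
qed simp

text \<open>Replacing each \<open>\<sigma> n\<close> by the representative of its class in
  \<open>T\<close> maps the finite set \<open>T\<close> injectively into itself, hence permutes it,
  and \<open>f\<close> does not see the replacement.\<close>

lemma (in comm_monoid) finprod_transversal:
  assumes "finite T" "T \<subseteq> K" "inj_on c T" "c ` T = c ` K"
    and f: "f \<in> K \<rightarrow> carrier G" "\<And>k k'. k \<in> K \<Longrightarrow> k' \<in> K \<Longrightarrow> c k = c k' \<Longrightarrow> f k = f k'"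
    and \<sigma>: "\<sigma> \<in> T \<rightarrow> K" "inj_on (\<lambda>n. c (\<sigma> n)) T"
  shows "finprod G (\<lambda>n. f (\<sigma> n)) T = finprod G (\<lambda>n. f n) T"
proof -
  define r where "r k = inv_into T c (c k)" for k
  have r: "r k \<in> T" "c (r k) = c k" if "k \<in> K" for k
  proof -
    have "c k \<in> c ` T"
      using that assms by blast
    then show "r k \<in> T" "c (r k) = c k"
      unfolding r_def by (auto intro: inv_into_into f_inv_into_f)
  qed
  have inj: "inj_on (\<lambda>n. r (\<sigma> n)) T"
    using \<sigma> r(2) unfolding inj_on_def by (metis PiE)
  have im: "(\<lambda>n. r (\<sigma> n)) ` T = T"
    by (intro endo_inj_surj[OF \<open>finite T\<close> _ inj]) (use r \<sigma> in auto)
  have "finprod G (\<lambda>n. f n) T = finprod G f ((\<lambda>n. r (\<sigma> n)) ` T)"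
    by (simp only: im)
  also have "\<dots> = finprod G (\<lambda>n. f (r (\<sigma> n))) T"
    using assms(2,5) by (intro finprod_reindex inj) (simp add: im, blast)
  also have "\<dots> = finprod G (\<lambda>n. f (\<sigma> n)) T"
    using assms(2,5) \<sigma> r by (intro finprod_cong' refl f(2)) (auto simp: Pi_def subset_iff)
  finally show ?thesis by simp
qed

section \<open>Powers, coprime exponents and cosets\<close>

lemma (in group) subgroup_nat_pow_closed:
  "subgroup S G \<Longrightarrow> z \<in> S \<Longrightarrow> z [^] (k::nat) \<in> S"
  by (induction k) (auto simp: subgroup.one_closed subgroup.m_closed)

text \<open>Bezout coefficients write \<open>x\<close> as a product of powers of
  \<open>x [^] a\<close> and \<open>x [^] b\<close>, one of them inverted. With \<open>S\<close>
  trivial, an element killed by two coprime exponents is trivial.\<close>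

lemma (in group) mem_subgroup_if_coprime_pows:
  assumes S: "subgroup S G" and x: "x \<in> carrier G"
    and ab: "x [^] (a::nat) \<in> S" "x [^] (b::nat) \<in> S" "coprime a b"
  shows "x \<in> S"
\<comment> \<open>\<open>bezout_nat\<close> requires \<open>a\<close> nonzero; for
  \<open>a = 0\<close> coprimality forces \<open>b = 1\<close>.\<close>
proof (cases "a = 0")
  case True
  then show ?thesis using assms by simp
next
  case False
  then obtain u v where "a * u = b * v + gcd a b"
    using bezout_nat by blast
  then have uv: "a * u = b * v + 1"
    using ab by simp
  have "(x [^] a) [^] u = (x [^] b) [^] v \<otimes> x"
    unfolding nat_pow_pow[OF x] uv by simp
  then have "x = inv ((x [^] b) [^] v) \<otimes> (x [^] a) [^] u"
    using x by (metis inv_solve_left nat_pow_closed)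
  then show ?thesis
    using S subgroup_nat_pow_closed ab by (metis subgroup.m_closed subgroup.m_inv_closed)
qed

lemma (in group) rcoset_eq_iff:
  assumes "subgroup U G" "x \<in> carrier G" "y \<in> carrier G"
  shows "U #> x = U #> y \<longleftrightarrow> x \<otimes> inv y \<in> U"
proof -
  have "U #> x = U #> y \<longleftrightarrow> x \<in> U #> y"
    using repr_independence[of x U y] rcos_self[of x U] assms by blast
  then show ?thesis
    using subgroup.rcos_module[OF assms(1) is_group, of y x] assms by simp
qed

lemma (in group) inv_mult_cancel:
  assumes "x \<in> carrier G" "y \<in> carrier G"
  shows "inv x \<otimes> (x \<otimes> y) = y" "x \<otimes> (inv x \<otimes> y) = y"
  using assms by (simp_all add: m_assoc[symmetric])

section \<open>The norm argument\<close>

text \<open>The telescoping identity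
  \<open>(a z)^m z^-m = a (z a z^-1) ... (z^(m-1) a z^-(m-1))\<close>, conjugated by
  \<open>g\<close> and transported by \<open>\<pi>\<close>. If \<open>(a z)^m\<close> and
  \<open>z^m\<close> are trivial, so is the product.\<close>

lemma (in group) prod_conj_pows:
  assumes "U \<lhd> G" "comm_group A" "\<pi> \<in> hom (G\<lparr>carrier := U\<rparr>) A"
    and "g \<in> carrier G" "z \<in> carrier G" "a \<in> U"
  shows "finprod A (\<lambda>i. \<pi> ((g \<otimes> z [^] i) \<otimes> a \<otimes> inv (g \<otimes> z [^] i))) {..<m::nat}
    = \<pi> (g \<otimes> ((a \<otimes> z) [^] m \<otimes> inv (z [^] m)) \<otimes> inv g)"
proof -
  interpret A: comm_group A by fact
  interpret U: normal U G by fact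
  interpret \<pi>: group_hom "G\<lparr>carrier := U\<rparr>" A \<pi>
    using assms U.subgroup_is_group[OF is_group] A.is_group
    by (intro group_hom.intro group_hom_axioms.intro)
  have a: "a \<in> carrier G" using assms by (simp add: U.mem_carrier)
  have cl: "\<pi> u \<in> carrier A" if "u \<in> U" for u
    using \<pi>.hom_closed that by simp
  have mult: "\<pi> (u \<otimes> v) = \<pi> u \<otimes>\<^bsub>A\<^esub> \<pi> v" if "u \<in> U" "v \<in> U" for u v
    using \<pi>.hom_mult that by simp
  have conj: "(g \<otimes> z [^] i) \<otimes> a \<otimes> inv (g \<otimes> z [^] i) \<in> U" for i :: nat
    using assms by (intro U.inv_op_closed2) auto
  have step: "(a \<otimes> z) [^] Suc m \<otimes> inv (z [^] Suc m)
      = ((a \<otimes> z) [^] m \<otimes> inv (z [^] m)) \<otimes> (z [^] m \<otimes> a \<otimes> inv (z [^] m))" for m :: nat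
    using a assms by (simp add: inv_mult_group m_assoc inv_mult_cancel)
  have inU: "(a \<otimes> z) [^] m \<otimes> inv (z [^] m) \<in> U" for m :: nat
  proof (induction m)
    case (Suc m)
    then show ?case unfolding step using assms by (intro U.m_closed[OF Suc] U.inv_op_closed2) auto
  qed (use a assms in auto)
  have inU': "g \<otimes> ((a \<otimes> z) [^] m \<otimes> inv (z [^] m)) \<otimes> inv g \<in> U" for m :: nat
    using assms inU by (intro U.inv_op_closed2)
  show ?thesis
  proof (induction m)
    case 0
    then show ?case using assms \<pi>.hom_one by simp
  next
    case (Suc m)
    have "finprod A (\<lambda>i. \<pi> ((g \<otimes> z [^] i) \<otimes> a \<otimes> inv (g \<otimes> z [^] i))) {..<Suc m}
      = \<pi> ((g \<otimes> z [^] m) \<otimes> a \<otimes> inv (g \<otimes> z [^] m)) \<otimes>\<^bsub>A\<^esub>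
        \<pi> (g \<otimes> ((a \<otimes> z) [^] m \<otimes> inv (z [^] m)) \<otimes> inv g)"
      unfolding lessThan_Suc Suc[symmetric]
      by (intro A.finprod_insert) (auto intro!: cl conj)
    also have "\<dots> = \<pi> ((g \<otimes> ((a \<otimes> z) [^] m \<otimes> inv (z [^] m)) \<otimes> inv g) \<otimes>
        ((g \<otimes> z [^] m) \<otimes> a \<otimes> inv (g \<otimes> z [^] m)))"
      unfolding mult[OF inU' conj] by (intro A.m_comm cl conj inU')
    also have "(g \<otimes> ((a \<otimes> z) [^] m \<otimes> inv (z [^] m)) \<otimes> inv g) \<otimes>
        ((g \<otimes> z [^] m) \<otimes> a \<otimes> inv (g \<otimes> z [^] m))
        = g \<otimes> ((a \<otimes> z) [^] Suc m \<otimes> inv (z [^] Suc m)) \<otimes> inv g"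
      unfolding step using a assms by (simp add: inv_mult_group m_assoc inv_mult_cancel)
    finally show ?case .
  qed
qed

lemma (in comm_monoid) finprod_pow_eq_one:
  assumes "finite I" "\<And>i. i \<in> I \<Longrightarrow> f i \<in> carrier G" "\<And>i. i \<in> I \<Longrightarrow> f i [^] (t::nat) = \<one>"
  shows "finprod G f I [^] t = \<one>"
  using assms
proof (induction I rule: finite_induct)
  case (insert i I)
  then show ?case
    by (simp add: nat_pow_distrib Pi_def)
qed simp

text \<open>
  \<open>\<pi>\<close> is a homomorphism from the normal subgroup \<open>U\<close> to an abelian group, so conjugation of
  \<open>a \<in> U\<close> followed by \<open>\<pi>\<close> depends only on the coset modulo \<open>U\<close> of the conjugating element. Let \<open>S\<close> be
  the product of these values over a transversal \<open>T\<close> of \<open>U\<close> in \<open>K\<close>. Grouping \<open>T\<close> along the powers of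
  \<open>y\<close> gives \<open>S\<^sup>t = 1\<close>. On the other hand, the product over \<open>n \<in> T\<close> and \<open>j < s\<close> of the conjugates by
  \<open>(x n)\<^sup>j\<close> is trivial; its terms with \<open>j = 0\<close> contribute \<open>\<pi> a\<close> to the power \<open>|T|\<close>, while those with a
  fixed \<open>j > 0\<close> run over the coset of \<open>x\<^sup>j\<close> and contribute a conjugate of \<open>S\<close>.
\<close>
lemma (in group) pow_index_eq_one:
  assumes fin: "finite (carrier G)" and U: "U \<lhd> G" and K: "K \<lhd> G" "U \<subseteq> K"
    and A: "comm_group A" "\<pi> \<in> hom (G\<lparr>carrier := U\<rparr>) A"
    and y: "y \<in> K" "\<And>u. u \<in> U \<Longrightarrow> (u \<otimes> y) [^] (t::nat) = \<one>"
    and x: "x \<in> carrier G" "Factorial_Ring.prime (s::nat)" "\<And>k. k \<in> K \<Longrightarrow> (x \<otimes> k) [^] s = \<one>"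
    and a: "a \<in> U"
  shows "\<pi> a [^]\<^bsub>A\<^esub> (card (rcosets\<^bsub>G\<lparr>carrier := K\<rparr>\<^esub> U) * t) = \<one>\<^bsub>A\<^esub>"
proof -
  interpret A: comm_group A by fact
  interpret U: normal U G by fact
  interpret K: normal K G by fact
  interpret \<pi>: group_hom "G\<lparr>carrier := U\<rparr>" A \<pi>
    using assms U.subgroup_is_group[OF is_group] A.is_group
    by (intro group_hom.intro group_hom_axioms.intro)
  note U_sub = U.subgroup_axioms
  have cl: "\<pi> u \<in> carrier A" if "u \<in> U" for u
    using \<pi>.hom_closed that by simp
  have mult: "\<pi> (u \<otimes> v) = \<pi> u \<otimes>\<^bsub>A\<^esub> \<pi> v" if "u \<in> U" "v \<in> U" for u v
    using \<pi>.hom_mult that by simp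
  have \<pi>_one: "\<pi> \<one> = \<one>\<^bsub>A\<^esub>"
    using \<pi>.hom_one by simp
  have yc: "y \<in> carrier G"
    using y(1) by (rule K.mem_carrier)
  define h where "h g b = \<pi> (g \<otimes> b \<otimes> inv g)" for g b
  have conj: "g \<otimes> b \<otimes> inv g \<in> U" if "g \<in> carrier G" "b \<in> U" for g b
    using that by (rule U.inv_op_closed2)
  have h_cl: "h g b \<in> carrier A" if "g \<in> carrier G" "b \<in> U" for g b
    unfolding h_def using that by (intro cl conj)
  have h_mult: "h (g \<otimes> k) b = h g (k \<otimes> b \<otimes> inv k)"
    if "g \<in> carrier G" "k \<in> carrier G" "b \<in> U" for g k b
    unfolding h_def using that by (simp add: m_assoc inv_mult_group)
  \<comment> \<open>As \<open>A\<close> is abelian, \<open>u c u^-1\<close> has the same image as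
    \<open>c\<close>; this is why only the coset modulo \<open>U\<close> matters.\<close>
  have h_U: "h (u \<otimes> g) b = h g b" if "u \<in> U" "g \<in> carrier G" "b \<in> U" for u g b
  proof -
    let ?c = "g \<otimes> b \<otimes> inv g"
    have c: "?c \<in> U"
      using that by (intro conj)
    have "h (u \<otimes> g) b = \<pi> ((u \<otimes> ?c) \<otimes> inv u)"
      unfolding h_def using that by (simp add: m_assoc inv_mult_group)
    also have "\<dots> = \<pi> ((inv u \<otimes> u) \<otimes> ?c)"
      using that c by (simp only: mult U.m_closed U.m_inv_closed A.m_ac cl)
    also have "\<dots> = h g b"
      using that c by (simp add: h_def)
    finally show ?thesis .
  qed
  have h_coset: "h g b = h g' b"
    if "U #> g = U #> g'" "g \<in> carrier G" "g' \<in> carrier G" "b \<in> U" for g g' b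
  proof -
    have "g \<otimes> inv g' \<in> U"
      using that rcoset_eq_iff[OF U_sub] by simp
    then have "h ((g \<otimes> inv g') \<otimes> g') b = h g' b"
      using that by (intro h_U)
    then show ?thesis
      using that by (simp add: m_assoc)
  qed
  obtain T where T: "T \<subseteq> K" "inj_on ((#>) U) T" "(#>) U ` K = (#>) U ` T"
    using subset_image_inj[of "(#>) U ` K" "(#>) U" K] by auto
  have finT: "finite T"
    using T(1) K.subset fin by (meson finite_subset)
  have card_T: "card (rcosets\<^bsub>G\<lparr>carrier := K\<rparr>\<^esub> U) = card T"
  proof -
    have "rcosets\<^bsub>G\<lparr>carrier := K\<rparr>\<^esub> U = (#>) U ` K"
      by (auto simp: RCOSETS_def)
    then show ?thesis
      using T card_image by metis
  qed
  have TK: "n \<in> K" "n \<in> carrier G" if "n \<in> T" for n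
    using T that by auto
  define S where "S j b = finprod A (\<lambda>n. h (x [^] j \<otimes> n) b) T" for j :: nat and b
  have S_cl: "S j b \<in> carrier A" if "b \<in> U" for j b
    unfolding S_def using that TK x by (intro A.finprod_closed) (auto intro!: h_cl)
  have transversal: "finprod A (\<lambda>n. h (x [^] j \<otimes> \<sigma> n) b) T = S j b"
    if "b \<in> U" "\<sigma> \<in> T \<rightarrow> K" "inj_on (\<lambda>n. U #> \<sigma> n) T" for j :: nat and b \<sigma>
    unfolding S_def
  proof (rule A.finprod_transversal[where c = "(#>) U" and K = K and f = "\<lambda>n. h (x [^] j \<otimes> n) b"])
    show "h (x [^] j \<otimes> k) b = h (x [^] j \<otimes> k') b"
      if "k \<in> K" "k' \<in> K" "U #> k = U #> k'" for k k'
    proof (rule h_coset)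
      have kc: "k \<in> carrier G" "k' \<in> carrier G"
        using that by auto
      \<comment> \<open>Normality of \<open>U\<close> makes left multiplication by
        \<open>x [^] j\<close> respect its right cosets.\<close>
      have "x [^] j \<otimes> (k \<otimes> inv k') \<otimes> inv (x [^] j) \<in> U"
        using that(3) kc x(1) rcoset_eq_iff[OF U_sub] by (intro conj) auto
      then have "(x [^] j \<otimes> k) \<otimes> inv (x [^] j \<otimes> k') \<in> U"
        using kc x(1) by (simp add: m_assoc inv_mult_group)
      then show "U #> (x [^] j \<otimes> k) = U #> (x [^] j \<otimes> k')"
        using kc x(1) rcoset_eq_iff[OF U_sub] by simp
    qed (use that \<open>b \<in> U\<close> x(1) in auto)
  qed (use that T finT x K.mem_carrier in \<open>auto intro!: h_cl\<close>)
  have S_t: "S j a [^]\<^bsub>A\<^esub> t = \<one>\<^bsub>A\<^esub>" for j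
  proof -
    have "S j a [^]\<^bsub>A\<^esub> t = finprod A (\<lambda>i. S j a) {..<t}"
      using S_cl a by (simp add: A.finprod_const)
    \<comment> \<open>The \<open>t\<close> copies of \<open>S j a\<close> are taken over the
      translated transversals \<open>T y^i\<close>; after the swap each inner product is a norm
      along the powers of \<open>y\<close>.\<close>
    also have "\<dots> = finprod A (\<lambda>i. finprod A (\<lambda>n. h (x [^] j \<otimes> n \<otimes> y [^] i) a) T) {..<t}"
    proof (rule A.finprod_cong')
      fix i assume "i \<in> {..<t}"
      have yi: "y [^] i \<in> K" "y [^] i \<in> carrier G"
        using y(1) by (auto intro!: subgroup_nat_pow_closed K.subgroup_axioms)
      have "inj_on (\<lambda>n. U #> (n \<otimes> y [^] i)) T"
      proof (rule inj_onI)
        fix n n' assume n: "n \<in> T" "n' \<in> T" and "U #> (n \<otimes> y [^] i) = U #> (n' \<otimes> y [^] i)"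
        then have "U #> n = U #> n'"
          using TK yi rcoset_eq_iff[OF U_sub] by (simp add: m_assoc inv_mult_group inv_mult_cancel)
        then show "n = n'"
          using T(2) n by (auto dest: inj_onD)
      qed
      then have "S j a = finprod A (\<lambda>n. h (x [^] j \<otimes> (n \<otimes> y [^] i)) a) T"
        using TK yi by (intro transversal[symmetric] a) auto
      then show "S j a = finprod A (\<lambda>n. h (x [^] j \<otimes> n \<otimes> y [^] i) a) T"
        using TK yi x a by (auto simp: m_assoc intro!: A.finprod_cong' h_cl)
    qed (use TK x a yc in \<open>auto intro!: A.finprod_closed h_cl\<close>)
    also have "\<dots> = finprod A (\<lambda>n. finprod A (\<lambda>i. h (x [^] j \<otimes> n \<otimes> y [^] i) a) {..<t}) T"
      using finT TK x a yc by (intro A.finprod_swap) (auto intro!: h_cl)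
    also have "\<dots> = \<one>\<^bsub>A\<^esub>"
    proof (rule A.finprod_one_eqI)
      fix n assume "n \<in> T"
      then have n: "n \<in> carrier G" by (rule TK)
      \<comment> \<open>The hypothesis on the coset \<open>U y\<close> is used at
        \<open>\<one>\<close> and at \<open>a\<close>, so both powers in the telescoped norm are
        trivial.\<close>
      have "(\<one> \<otimes> y) [^] t = \<one>" "(a \<otimes> y) [^] t = \<one>"
        using y(2)[OF U.one_closed] y(2)[OF a] by auto
      then show "finprod A (\<lambda>i. h (x [^] j \<otimes> n \<otimes> y [^] i) a) {..<t} = \<one>\<^bsub>A\<^esub>"
        unfolding h_def using prod_conj_pows[OF U A, of "x [^] j \<otimes> n" y a t] n x yc a \<pi>_one
        by simp
    qed
    finally show ?thesis .
  qed
  \<comment> \<open>\<open>(x n)^j\<close> is \<open>x^j\<close> times a correction in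
    \<open>K\<close>. The corrections meet distinct cosets of \<open>U\<close>, so
    \<open>transversal\<close> applies to them.\<close>
  have S_pow: "finprod A (\<lambda>n. h ((x \<otimes> n) [^] j) a) T = S j a" if "coprime j s" for j
  proof -
    have "finprod A (\<lambda>n. h ((x \<otimes> n) [^] j) a) T
        = finprod A (\<lambda>n. h (x [^] j \<otimes> (inv (x [^] j) \<otimes> (x \<otimes> n) [^] j)) a) T"
      using TK x by (intro A.finprod_cong') (auto simp: inv_mult_cancel intro!: h_cl a)
    also have "\<dots> = S j a"
    proof (rule transversal[OF a])
      have "inv (x [^] i) \<otimes> (x \<otimes> n) [^] i \<in> K" if "n \<in> K" for n and i :: nat
      proof (induction i)
        case (Suc i)
        have n: "n \<in> carrier G"
          using that by auto
        have "inv (x [^] Suc i) \<otimes> (x \<otimes> n) [^] Suc i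
            = inv x \<otimes> (inv (x [^] i) \<otimes> (x \<otimes> n) [^] i) \<otimes> x \<otimes> n"
          using n x(1) by (simp add: m_assoc inv_mult_group)
        then show ?case
          using that x(1) Suc K.inv_op_closed1 K.m_closed by metis
      qed simp
      then show "(\<lambda>n. inv (x [^] j) \<otimes> (x \<otimes> n) [^] j) \<in> T \<rightarrow> K"
        using TK by auto
    next
      have "j \<noteq> 0"
        using that x(2) by (metis coprime_0_left_iff not_prime_unit)
      then obtain u v where "j * u = s * v + gcd j s"
        using bezout_nat by blast
      then have uv: "j * u = s * v + 1"
        using that by simp
      \<comment> \<open>\<open>u\<close> inverts \<open>j\<close> modulo \<open>s\<close>, so
        raising to \<open>u\<close> recovers the coset of \<open>x n\<close> from that of its
        \<open>j\<close>-th power.\<close>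
      have quot: "U #> (x \<otimes> n) = (U #> (x \<otimes> n) [^] j) [^]\<^bsub>G Mod U\<^esub> u" if "n \<in> T" for n
      proof -
        have xn: "x \<otimes> n \<in> carrier G"
          using x(1) TK[OF that] by simp
        have "((x \<otimes> n) [^] j) [^] u = ((x \<otimes> n) [^] s) [^] v \<otimes> (x \<otimes> n)"
          unfolding nat_pow_pow[OF xn] uv by simp
        also have "(x \<otimes> n) [^] s = \<one>"
          by (rule x(3)[OF TK(1)[OF that]])
        finally have "((x \<otimes> n) [^] j) [^] u = x \<otimes> n"
          using xn by simp
        then show ?thesis
          using U.FactGroup_pow[of "(x \<otimes> n) [^] j" u] xn by simp
      qed
      show "inj_on (\<lambda>n. U #> (inv (x [^] j) \<otimes> (x \<otimes> n) [^] j)) T"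
      proof (rule inj_onI)
        fix n n' assume n: "n \<in> T" "n' \<in> T"
          and eq: "U #> (inv (x [^] j) \<otimes> (x \<otimes> n) [^] j) = U #> (inv (x [^] j) \<otimes> (x \<otimes> n') [^] j)"
        note nc = TK(2)[OF n(1)] TK(2)[OF n(2)]
        have "inv (x [^] j) \<otimes> (x \<otimes> n) [^] j \<otimes> inv (inv (x [^] j) \<otimes> (x \<otimes> n') [^] j) \<in> U"
          using eq nc x(1) rcoset_eq_iff[OF U_sub] by simp
        then have "x [^] j \<otimes> (inv (x [^] j) \<otimes> (x \<otimes> n) [^] j \<otimes> inv (inv (x [^] j) \<otimes> (x \<otimes> n') [^] j))
            \<otimes> inv (x [^] j) \<in> U"
          using x(1) by (intro conj) auto
        then have "(x \<otimes> n) [^] j \<otimes> inv ((x \<otimes> n') [^] j) \<in> U"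
          using nc x(1) by (simp add: m_assoc inv_mult_group inv_mult_cancel)
        then have "U #> (x \<otimes> n) [^] j = U #> (x \<otimes> n') [^] j"
          using nc x(1) rcoset_eq_iff[OF U_sub] by simp
        then have "U #> (x \<otimes> n) = U #> (x \<otimes> n')"
          using quot n by simp
        then have "inv x \<otimes> ((x \<otimes> n) \<otimes> inv (x \<otimes> n')) \<otimes> x \<in> U"
          using nc x(1) rcoset_eq_iff[OF U_sub] by (intro U.inv_op_closed1) auto
        then have "U #> n = U #> n'"
          using nc x(1) rcoset_eq_iff[OF U_sub] by (simp add: m_assoc inv_mult_group inv_mult_cancel)
        then show "n = n'"
          using T(2) n by (auto dest: inj_onD)
      qed
    qed
    finally show ?thesis .
  qed
  have "\<one>\<^bsub>A\<^esub> = finprod A (\<lambda>n. finprod A (\<lambda>j. h ((x \<otimes> n) [^] j) a) {..<s}) T"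
  proof (rule A.finprod_one_eqI[symmetric])
    fix n assume n: "n \<in> T"
    \<comment> \<open>\<open>a x n\<close> is \<open>x\<close> times this element of
      \<open>K\<close>, so the hypothesis on the coset of \<open>x\<close> also gives
      \<open>(a x n)^s = 1\<close>.\<close>
    have "inv x \<otimes> a \<otimes> x \<otimes> n \<in> K"
      using n x(1) a TK K(2) by (intro K.m_closed K.inv_op_closed1) auto
    then have "(x \<otimes> (inv x \<otimes> a \<otimes> x \<otimes> n)) [^] s = \<one>"
      by (rule x)
    then have "(a \<otimes> (x \<otimes> n)) [^] s = \<one>"
      using x(1) a TK[OF n] by (simp add: m_assoc inv_mult_cancel)
    moreover have "(x \<otimes> n) [^] s = \<one>"
      by (rule x(3)[OF TK(1)[OF n]])
    ultimately show "finprod A (\<lambda>j. h ((x \<otimes> n) [^] j) a) {..<s} = \<one>\<^bsub>A\<^esub>"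
      unfolding h_def using prod_conj_pows[OF U A, of \<one> "x \<otimes> n" a s] TK[OF n] x(1) a \<pi>_one
      by simp
  qed
  also have "\<dots> = finprod A (\<lambda>j. finprod A (\<lambda>n. h ((x \<otimes> n) [^] j) a) T) {..<s}"
    using finT TK x a yc by (intro A.finprod_swap) (auto intro!: h_cl)
  also have "{..<s} = insert 0 {1..<s}"
    using prime_gt_0_nat[OF x(2)] by auto
  also have "finprod A (\<lambda>j. finprod A (\<lambda>n. h ((x \<otimes> n) [^] j) a) T) (insert 0 {1..<s})
      = \<pi> a [^]\<^bsub>A\<^esub> card T \<otimes>\<^bsub>A\<^esub> finprod A (\<lambda>j. S j a) {1..<s}"
  proof -
    have cop: "coprime j s" if "j \<in> {1..<s}" for j
      using that x(2) by (metis atLeastLessThan_iff coprime_commute less_numeral_extra(1)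
          nat_dvd_not_less order_less_le_trans prime_imp_coprime)
    have "finprod A (\<lambda>n. h ((x \<otimes> n) [^] (0::nat)) a) T = \<pi> a [^]\<^bsub>A\<^esub> card T"
      using a cl by (simp add: h_def A.finprod_const)
    moreover have "finprod A (\<lambda>j. finprod A (\<lambda>n. h ((x \<otimes> n) [^] j) a) T) {1..<s}
        = finprod A (\<lambda>j. S j a) {1..<s}"
      using cop S_pow S_cl a by (intro A.finprod_cong') auto
    ultimately show ?thesis
      using TK x(1) a by (subst A.finprod_insert) (auto intro!: h_cl A.finprod_closed)
  qed
  \<comment> \<open>Raising to the power \<open>t\<close> removes the factors with
    \<open>j > 0\<close> and leaves only a power of \<open>\<pi> a\<close>.\<close>
  finally have "(\<pi> a [^]\<^bsub>A\<^esub> card T \<otimes>\<^bsub>A\<^esub> finprod A (\<lambda>j. S j a) {1..<s}) [^]\<^bsub>A\<^esub> t = \<one>\<^bsub>A\<^esub>"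
    by (metis A.nat_pow_one)
  moreover have "finprod A (\<lambda>j. S j a) {1..<s} [^]\<^bsub>A\<^esub> t = \<one>\<^bsub>A\<^esub>"
    using S_cl S_t a by (intro A.finprod_pow_eq_one) auto
  ultimately show ?thesis
    using S_cl a cl card_T by (simp add: A.nat_pow_distrib A.nat_pow_pow A.finprod_closed Pi_def)
qed

subsection \<open>Groups with elements of prime order outside a normal subgroup\<close>

text \<open>Cauchy's theorem. \<open>sylow_thm\<close> provides a subgroup for any prime power
  dividing the order, so the exponent can be taken to be 1.\<close>

lemma (in group) exists_elem_of_prime_order:
  assumes fin: "finite (carrier G)" and p: "Factorial_Ring.prime p" "p dvd order G"
  obtains x where "x \<in> carrier G" "x \<noteq> \<one>" "x [^] p = \<one>"
proof -
  obtain m where m: "order G = p ^ 1 * m"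
    using p(2) by auto
  then obtain S where S: "subgroup S G" "card S = p"
    using sylow_thm[OF p(1) is_group m fin] by auto
  then have finS: "finite S"
    using p(1) by (metis card.infinite not_prime_0)
  have "S \<noteq> {\<one>}"
    using S(2) p(1) by auto
  then obtain x where x: "x \<in> S" "x \<noteq> \<one>"
    using subgroup.one_closed[OF S(1)] by blast
  interpret S: group "G\<lparr>carrier := S\<rparr>"
    by (rule subgroup_imp_group[OF S(1)])
  have "x [^]\<^bsub>G\<lparr>carrier := S\<rparr>\<^esub> order (G\<lparr>carrier := S\<rparr>) = \<one>"
    using S.pow_order_eq_1[of x] finS x by simp
  then have "x [^] p = \<one>"
    using S(2) by (simp add: nat_pow_consistent[symmetric] order_def)
  then show ?thesis
    using that x subgroup.mem_carrier[OF S(1)] by blast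
qed

text \<open>By Cauchy's theorem, a prime divisor of the order other than \<open>q\<close> would give
  a nontrivial element killed by that prime and by a power of \<open>q\<close>.\<close>

lemma (in group) order_eq_prime_power:
  assumes fin: "finite (carrier G)" and q: "Factorial_Ring.prime q"
    and pows: "\<And>x. x \<in> carrier G \<Longrightarrow> \<exists>n. x [^] (q ^ n) = \<one>"
  obtains m where "order G = q ^ m"
proof -
  obtain k where k: "order G = q ^ multiplicity q (order G) * k" "\<not> q dvd k"
    using multiplicity_decompose'[of "order G" q] prime_gt_1_nat[OF q] fin order_gt_0_iff_finite by auto
  have "k = 1"
  proof (rule ccontr)
    assume "k \<noteq> 1"
    then obtain r where r: "Factorial_Ring.prime r" "r dvd k"
      using prime_factor_nat by blast
    then have "r dvd order G"
      using k(1) by (metis dvd_mult)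
    then obtain x where x: "x \<in> carrier G" "x \<noteq> \<one>" "x [^] r = \<one>"
      using exists_elem_of_prime_order[OF fin r(1)] by blast
    obtain n where n: "x [^] (q ^ n) = \<one>"
      using pows[OF x(1)] by blast
    have "coprime r (q ^ n)"
      using r k(2) q by (metis coprime_power_right_iff primes_coprime)
    then have "x \<in> {\<one>}"
      using mem_subgroup_if_coprime_pows[OF triv_subgroup x(1)] x(3) n by blast
    then show False
      using x(2) by simp
  qed
  then show ?thesis
    using that k(1) by simp
qed

section \<open>Powers modulo a normal subgroup\<close>

lemma (in normal) rcoset_eq_self_iff:
  "x \<in> carrier G \<Longrightarrow> H #> x = H \<longleftrightarrow> x \<in> H"
  using coset_join1[of H x] coset_join2[of x H] subgroup_axioms by blast

lemma (in normal) pow_mem_iff: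
  assumes "x \<in> carrier G" "y \<in> carrier G" "H #> x = H #> y"
  shows "x [^] (n::nat) \<in> H \<longleftrightarrow> y [^] n \<in> H"
proof -
  have "H #> x [^] n = H #> y [^] n"
    using FactGroup_pow[of x n] FactGroup_pow[of y n] assms by simp
  then show ?thesis
    using rcoset_eq_self_iff[of "x [^] n"] rcoset_eq_self_iff[of "y [^] n"] assms by simp
qed

text \<open>The prime order \<open>s\<close> of \<open>g\<close> must be \<open>p\<close>: otherwise
  \<open>g [^] s\<close> and \<open>g [^] p\<close> lie in \<open>N\<close> with coprime exponents,
  which puts \<open>g\<close> into \<open>N\<close>.\<close>

lemma (in group) prime_pow_eq_one_outside:
  assumes N: "N \<lhd> G" and g: "g \<in> carrier G" "g \<notin> N" "g [^] (p::nat) \<in> N" "Factorial_Ring.prime p"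
    and primes: "\<And>g. g \<in> carrier G \<Longrightarrow> g \<notin> N \<Longrightarrow> \<exists>s::nat. Factorial_Ring.prime s \<and> g [^] s = \<one>"
  shows "g [^] p = \<one>"
proof -
  interpret N: normal N G by fact
  obtain s :: nat where s: "Factorial_Ring.prime s" "g [^] s = \<one>"
    using primes g by blast
  have "s = p"
  proof (rule ccontr)
    assume "s \<noteq> p"
    then have "coprime s p"
      using s g(4) by (simp add: primes_coprime)
    then show False
      using mem_subgroup_if_coprime_pows[OF N.subgroup_axioms g(1), of s p] s g N.one_closed by simp
  qed
  then show ?thesis
    using s by simp
qed

text \<open>The norm argument with \<open>A = U / U'\<close> and the projection as
  \<open>\<pi>\<close>. Since \<open>K / U\<close> is a \<open>q\<close>-group, its order times the
  exponent \<open>q\<close> of the coset \<open>U y\<close> is again a power of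
  \<open>q\<close>.\<close>

lemma (in group) pow_mem_derived:
  assumes fin: "finite (carrier G)" and U: "U \<lhd> G" and K: "K \<lhd> G" "U \<subseteq> K"
    and q: "Factorial_Ring.prime (q::nat)" "\<And>k. k \<in> K \<Longrightarrow> \<exists>n. k [^] (q ^ n) \<in> U"
    and y: "y \<in> K" "\<And>u. u \<in> U \<Longrightarrow> (u \<otimes> y) [^] q = \<one>"
    and x: "x \<in> carrier G" "x \<notin> K"
    and primes: "\<And>g. g \<in> carrier G \<Longrightarrow> g \<notin> K \<Longrightarrow> \<exists>s::nat. Factorial_Ring.prime s \<and> g [^] s = \<one>"
    and a: "a \<in> U"
  shows "\<exists>n. a [^] (q ^ n) \<in> derived G U"
proof -
  interpret U: normal U G by fact
  interpret K: normal K G by fact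
  interpret UG: group "G\<lparr>carrier := U\<rparr>"
    by (rule subgroup_imp_group[OF U.subgroup_axioms])
  interpret UK: normal U "G\<lparr>carrier := K\<rparr>"
    by (rule normal_restrict_supergroup[OF K.subgroup_axioms U K(2)])
  interpret D: normal "derived G U" "G\<lparr>carrier := U\<rparr>"
    by (rule derived_subgroup_is_normal[OF U.subgroup_axioms])
  interpret Q: group "G\<lparr>carrier := K\<rparr> Mod U"
    by (rule UK.factorgroup_is_group)
  have Kfin: "finite K"
    using K.subset fin finite_subset by blast
  have carrQ: "carrier (G\<lparr>carrier := K\<rparr> Mod U) = (#>) U ` K"
    by (auto simp: carrier_FactGroup)
  obtain m where m: "order (G\<lparr>carrier := K\<rparr> Mod U) = q ^ m"
  proof (rule Q.order_eq_prime_power[OF _ q(1)])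
    fix X assume "X \<in> carrier (G\<lparr>carrier := K\<rparr> Mod U)"
    then obtain k where k: "k \<in> K" "X = U #> k"
      using carrQ by auto
    obtain n where "k [^] (q ^ n) \<in> U"
      using q(2) k by blast
    then have "X [^]\<^bsub>G\<lparr>carrier := K\<rparr> Mod U\<^esub> (q ^ n) = U"
      using UK.FactGroup_pow[of k "q ^ n"] k U.rcos_const[OF is_group]
      by (simp add: nat_pow_consistent[symmetric])
    then show "\<exists>n. X [^]\<^bsub>G\<lparr>carrier := K\<rparr> Mod U\<^esub> (q ^ n) = \<one>\<^bsub>G\<lparr>carrier := K\<rparr> Mod U\<^esub>"
      by auto
  qed (use Kfin carrQ in auto)
  obtain s :: nat where s: "Factorial_Ring.prime s" "x [^] s = \<one>"
    using primes x by blast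
  \<comment> \<open>All of the coset \<open>x K\<close> has the exponent of \<open>x\<close>: its
    members lie outside \<open>K\<close>, while their \<open>s\<close>-th powers lie in
    \<open>K\<close>.\<close>
  have xk: "(x \<otimes> k) [^] s = \<one>" if k: "k \<in> K" for k
  proof (rule prime_pow_eq_one_outside[OF K(1)])
    show xk: "x \<otimes> k \<in> carrier G"
      using x(1) k by simp
    have "x \<otimes> k \<otimes> inv x \<in> K"
      using x(1) k by (rule K.inv_op_closed2)
    then have eq: "K #> (x \<otimes> k) = K #> x"
      using rcoset_eq_iff[OF K.subgroup_axioms xk x(1)] by simp
    then show "(x \<otimes> k) [^] s \<in> K"
      using K.pow_mem_iff[OF xk x(1) eq, of s] s by simp
    show "x \<otimes> k \<notin> K"
      using K.pow_mem_iff[OF xk x(1) eq, of 1] x xk by simp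
  qed (use s primes in auto)
  let ?\<pi> = "\<lambda>u. derived G U #>\<^bsub>G\<lparr>carrier := U\<rparr>\<^esub> u"
  let ?N = "card (rcosets\<^bsub>G\<lparr>carrier := K\<rparr>\<^esub> U) * q"
  have "?\<pi> a [^]\<^bsub>G\<lparr>carrier := U\<rparr> Mod derived G U\<^esub> ?N = \<one>\<^bsub>G\<lparr>carrier := U\<rparr> Mod derived G U\<^esub>"
    by (rule pow_index_eq_one[OF fin U K derived_quot_of_subgroup_is_comm_group[OF U.subgroup_axioms]
          D.r_coset_hom_Mod y x(1) s(1) xk a])
  then have "?\<pi> (a [^] ?N) = derived G U"
    using D.FactGroup_pow[of a ?N] a by (simp add: nat_pow_consistent[symmetric])
  then have "a [^] ?N \<in> derived G U"
    using D.rcoset_eq_self_iff[of "a [^] ?N"] a subgroup_nat_pow_closed[OF U.subgroup_axioms] by simp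
  moreover have "?N = q ^ Suc m"
    using m by (simp add: order_def FactGroup_def)
  ultimately show ?thesis
    by metis
qed

section \<open>Abelian layers of prime exponent\<close>

lemma (in group) exp_of_derived_is_normal:
  "N \<lhd> G \<Longrightarrow> (derived G ^^ n) N \<lhd> G"
  by (induction n) (auto intro: derived_is_normal)

lemma (in group) commutator_mem_derived:
  "x \<in> M \<Longrightarrow> y \<in> M \<Longrightarrow> x \<otimes> y \<otimes> inv x \<otimes> inv y \<in> derived G M"
  unfolding derived_def by (intro generate.incl) blast

text \<open>\<open>M\<close> is \<open>N D\<close>, with \<open>D\<close> the last term of the
  derived series of \<open>G\<close> not contained in \<open>N\<close>, so \<open>M / N\<close> is
  abelian and nontrivial. Its nontrivial elements have prime order, and two different primes would
  produce an element of composite order.\<close>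

lemma (in group) exists_exponent_layer:
  assumes sol: "solvable G" and N: "N \<lhd> G" "N \<noteq> carrier G"
    and primes: "\<And>g. g \<in> carrier G \<Longrightarrow> g \<notin> N \<Longrightarrow> \<exists>s::nat. Factorial_Ring.prime s \<and> g [^] s = \<one>"
  obtains M q where "M \<lhd> G" "N \<subset> M" "derived G M \<subseteq> N" "Factorial_Ring.prime (q::nat)"
    "\<And>x. x \<in> M \<Longrightarrow> x [^] q \<in> N"
proof -
  interpret N: normal N G by fact
  obtain n where "(derived G ^^ n) (carrier G) = {\<one>}"
    using sol solvable_iff_trivial_derived_seq by blast
  then have "(derived G ^^ n) (carrier G) \<subseteq> N"
    by simp
  \<comment> \<open>Term 0 is not inside \<open>N\<close>, so the first term inside \<open>N\<close>
    has an index of the form \<open>Suc k\<close>.\<close>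
  moreover have "\<not> (derived G ^^ 0) (carrier G) \<subseteq> N"
    using N N.subset by auto
  ultimately obtain k where "\<forall>i\<le>k. \<not> (derived G ^^ i) (carrier G) \<subseteq> N"
      and k: "(derived G ^^ Suc k) (carrier G) \<subseteq> N"
    using ex_least_nat_less[of "\<lambda>i. (derived G ^^ i) (carrier G) \<subseteq> N" n] by blast
  then have k': "\<not> (derived G ^^ k) (carrier G) \<subseteq> N"
    by blast
  define D where "D = (derived G ^^ k) (carrier G)"
  have D: "D \<lhd> G" "\<not> D \<subseteq> N" "derived G D \<subseteq> N"
    using k k' exp_of_derived_is_normal[OF normal_self] by (auto simp: D_def)
  interpret D: normal D G by fact
  interpret ND: second_isomorphism_grp N G D
    by (intro second_isomorphism_grp.intro N second_isomorphism_grp_axioms.intro D.subgroup_axioms)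
  define M where "M = N <#> D"
  have M: "M \<lhd> G"
    unfolding normal_inv_iff
  proof (intro conjI ballI)
    show "subgroup M G"
      unfolding M_def by (rule ND.normal_set_mult_subgroup)
    fix g m assume g: "g \<in> carrier G" and "m \<in> M"
    then obtain a d where m: "a \<in> N" "d \<in> D" "m = a \<otimes> d"
      unfolding M_def set_mult_def by auto
    have "g \<otimes> m \<otimes> inv g = (g \<otimes> a \<otimes> inv g) \<otimes> (g \<otimes> d \<otimes> inv g)"
      using g m by (simp add: m_assoc inv_mult_cancel)
    then show "g \<otimes> m \<otimes> inv g \<in> M"
      using N.inv_op_closed2[OF g m(1)] D.inv_op_closed2[OF g m(2)]
      unfolding M_def set_mult_def by auto
  qed
  interpret M: normal M G by fact
  have NM: "N \<subset> M"
    using ND.H_contained_in_set_mult ND.S_contained_in_set_mult D(2) unfolding M_def by auto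
  interpret Q: group "G Mod N"
    by (rule N.factorgroup_is_group)
  interpret \<phi>: group_hom G "G Mod N" "(#>) N"
    using N.r_coset_hom_Mod by unfold_locales
  have ker: "N #> x = \<one>\<^bsub>G Mod N\<^esub> \<longleftrightarrow> x \<in> N" if "x \<in> carrier G" for x
    using N.rcoset_eq_self_iff[OF that] by simp
  have commutes: "x \<otimes> y \<otimes> inv x \<otimes> inv y \<in> N" if xy: "x \<in> M" "y \<in> M" for x y
  proof -
    \<comment> \<open>Modulo \<open>N\<close> every element of \<open>M\<close> has a representative
      in \<open>D\<close>, and commutators of elements of \<open>D\<close> already lie in
      \<open>N\<close>.\<close>
    have "\<exists>d\<in>D. N #> m = N #> d" if mM: "m \<in> M" for m
    proof -
      obtain a d where m: "a \<in> N" "d \<in> D" "m = a \<otimes> d"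
        using mM unfolding M_def set_mult_def by auto
      then have "N #> m = N #> d"
        using rcoset_eq_iff[OF N.subgroup_axioms, of m d] by (simp add: m_assoc)
      then show ?thesis
        using m by blast
    qed
    then obtain d e where de: "d \<in> D" "e \<in> D" "N #> x = N #> d" "N #> y = N #> e"
      using xy by metis
    then have "N #> (x \<otimes> y \<otimes> inv x \<otimes> inv y) = N #> (d \<otimes> e \<otimes> inv d \<otimes> inv e)"
      using that by (simp only: \<phi>.hom_mult \<phi>.hom_inv m_closed inv_closed M.mem_carrier D.mem_carrier)
    moreover have "d \<otimes> e \<otimes> inv d \<otimes> inv e \<in> N"
      using de D(3) commutator_mem_derived by blast
    ultimately show ?thesis
      using ker that de by (metis M.mem_carrier D.mem_carrier inv_closed m_closed)
  qed
  have der: "derived G M \<subseteq> N"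
    unfolding derived_def using commutes
    by (intro generate_subgroup_incl N.subgroup_axioms) blast
  obtain y where y: "y \<in> M" "y \<notin> N"
    using NM by blast
  then have yc: "y \<in> carrier G"
    by simp
  \<comment> \<open>\<open>q\<close> comes from one arbitrary \<open>y\<close> in \<open>M\<close>
    outside \<open>N\<close>; the rest shows that it serves for every \<open>x\<close> in
    \<open>M\<close>.\<close>
  obtain q :: nat where q: "Factorial_Ring.prime q" "y [^] q = \<one>"
    using primes y yc by blast
  have "x [^] q \<in> N" if x: "x \<in> M" for x
  proof (rule ccontr)
    assume xq: "x [^] q \<notin> N"
    then have xN: "x \<notin> N"
      using subgroup_nat_pow_closed[OF N.subgroup_axioms] by blast
    have xc: "x \<in> carrier G"
      using x by simp
    obtain r :: nat where r: "Factorial_Ring.prime r" "x [^] r = \<one>"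
      using primes xN xc by blast
    have rq: "r \<noteq> q"
      using xq r by auto
    let ?X = "N #> x" and ?Y = "N #> y"
    have XY: "?X \<in> carrier (G Mod N)" "?Y \<in> carrier (G Mod N)"
      using xc yc by auto
    \<comment> \<open>\<open>x\<close> and \<open>y\<close> commute only modulo \<open>N\<close>, so
      powers of their product are computed in \<open>G Mod N\<close>.\<close>
    have comm: "?X \<otimes>\<^bsub>G Mod N\<^esub> ?Y = ?Y \<otimes>\<^bsub>G Mod N\<^esub> ?X"
    proof -
      have "(x \<otimes> y) \<otimes> inv (y \<otimes> x) \<in> N"
        using commutes[OF x y(1)] xc yc by (simp add: inv_mult_group m_assoc)
      then have "N #> (x \<otimes> y) = N #> (y \<otimes> x)"
        using rcoset_eq_iff[OF N.subgroup_axioms, of "x \<otimes> y" "y \<otimes> x"] xc yc m_closed by blast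
      then show ?thesis
        using xc yc by (simp only: \<phi>.hom_mult)
    qed
    have powX: "?X [^]\<^bsub>G Mod N\<^esub> i = \<one>\<^bsub>G Mod N\<^esub> \<longleftrightarrow> x [^] i \<in> N" for i :: nat
      using N.FactGroup_pow[OF xc] ker xc by simp
    have powY: "?Y [^]\<^bsub>G Mod N\<^esub> i = \<one>\<^bsub>G Mod N\<^esub> \<longleftrightarrow> y [^] i \<in> N" for i :: nat
      using N.FactGroup_pow[OF yc] ker yc by simp
    have XYpow: "(?X \<otimes>\<^bsub>G Mod N\<^esub> ?Y) [^]\<^bsub>G Mod N\<^esub> i
        = ?X [^]\<^bsub>G Mod N\<^esub> i \<otimes>\<^bsub>G Mod N\<^esub> ?Y [^]\<^bsub>G Mod N\<^esub> i" for i :: nat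
      using Q.pow_mult_distrib[OF comm XY] .
    have Xr: "?X [^]\<^bsub>G Mod N\<^esub> r = \<one>\<^bsub>G Mod N\<^esub>" and Yq: "?Y [^]\<^bsub>G Mod N\<^esub> q = \<one>\<^bsub>G Mod N\<^esub>"
      using powX powY r q by simp_all
    have "\<exists>s::nat. Factorial_Ring.prime s \<and> (?X \<otimes>\<^bsub>G Mod N\<^esub> ?Y) [^]\<^bsub>G Mod N\<^esub> s = \<one>\<^bsub>G Mod N\<^esub>"
    proof (cases "x \<otimes> y \<in> N")
      case True
      then have "?X \<otimes>\<^bsub>G Mod N\<^esub> ?Y = \<one>\<^bsub>G Mod N\<^esub>"
        using ker xc yc by (simp only: \<phi>.hom_mult[symmetric] m_closed)
      then show ?thesis
        using q(1) Q.nat_pow_one by metis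
    next
      case False
      then obtain s :: nat where "Factorial_Ring.prime s" "(x \<otimes> y) [^] s = \<one>"
        using primes xc yc by blast
      then show ?thesis
        using N.FactGroup_pow[of "x \<otimes> y" s] xc yc by (metis \<phi>.hom_mult \<phi>.hom_one m_closed)
    qed
    then obtain s :: nat where s: "Factorial_Ring.prime s"
        "?X [^]\<^bsub>G Mod N\<^esub> s \<otimes>\<^bsub>G Mod N\<^esub> ?Y [^]\<^bsub>G Mod N\<^esub> s = \<one>\<^bsub>G Mod N\<^esub>"
      unfolding XYpow by blast
    \<comment> \<open>Multiplying the exponent by \<open>q\<close> kills \<open>?Y\<close>, hence
      also \<open>?X\<close>, which forces \<open>r = s\<close>; multiplying by \<open>r\<close>
      forces \<open>q = s\<close> in the same way.\<close>
    have mult: "?X [^]\<^bsub>G Mod N\<^esub> (s * i) \<otimes>\<^bsub>G Mod N\<^esub> ?Y [^]\<^bsub>G Mod N\<^esub> (s * i) = \<one>\<^bsub>G Mod N\<^esub>"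
      for i :: nat
      using s(2) XY XYpow Q.nat_pow_one Q.nat_pow_pow Q.m_closed by metis
    have Yq': "?Y [^]\<^bsub>G Mod N\<^esub> (s * q) = \<one>\<^bsub>G Mod N\<^esub>"
      using Yq XY(2) by (metis Q.nat_pow_pow Q.nat_pow_one mult.commute)
    have Xr': "?X [^]\<^bsub>G Mod N\<^esub> (s * r) = \<one>\<^bsub>G Mod N\<^esub>"
      using Xr XY(1) by (metis Q.nat_pow_pow Q.nat_pow_one mult.commute)
    have "x [^] (s * q) \<in> N"
      using mult[of q] Yq' powX[of "s * q"] XY by (metis Q.r_one Q.nat_pow_closed)
    then have "\<not> coprime r (s * q)"
      using mem_subgroup_if_coprime_pows[OF N.subgroup_axioms xc, of r "s * q"] r xN by auto
    then have "r = s"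
      using r q s rq by (metis coprime_mult_right_iff primes_coprime)
    moreover have "y [^] (s * r) \<in> N"
      using mult[of r] Xr' powY[of "s * r"] XY by (metis Q.l_one Q.nat_pow_closed)
    then have "\<not> coprime q (s * r)"
      using mem_subgroup_if_coprime_pows[OF N.subgroup_axioms yc, of q "s * r"] q y by auto
    then have "q = s"
      using r q s rq by (metis coprime_mult_right_iff primes_coprime)
    ultimately show False
      using rq by simp
  qed
  then show ?thesis
    using that M NM der q(1) by blast
qed

lemma (in group) subgroup_mult_mem_cancel:
  assumes "subgroup S G" "u \<in> S" "y \<in> carrier G" "u \<otimes> y \<in> S"
  shows "y \<in> S"
proof -
  have "inv u \<otimes> (u \<otimes> y) \<in> S"
    by (rule subgroup.m_closed[OF assms(1) subgroup.m_inv_closed[OF assms(1,2)] assms(4)])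
  then show ?thesis
    unfolding inv_mult_cancel(1)[OF subgroup.mem_carrier[OF assms(1,2)] assms(3)] .
qed

section \<open>Construction of the kernel\<close>

lemma (in group) frobenius_kernel_splitting:
  assumes fin: "finite (carrier G)" and sol: "solvable G" and H: "H \<lhd> G"
    and primes: "\<And>g. g \<in> carrier G \<Longrightarrow> g \<notin> H \<Longrightarrow> \<exists>s::nat. Factorial_Ring.prime s \<and> g [^] s = \<one>"
    and two: "\<And>q::nat. Factorial_Ring.prime q \<Longrightarrow> \<exists>x \<in> carrier G - H. x [^] q \<noteq> \<one>"
  obtains F x p q where "F \<lhd> G" "H \<subset> F" "Factorial_Ring.prime (p::nat)" "Factorial_Ring.prime (q::nat)"
    "p \<noteq> q" "\<And>f. f \<in> F \<Longrightarrow> \<exists>n. f [^] (q ^ n) = \<one>" "x \<in> carrier G" "x \<notin> F"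
    "F <#> generate G {x} = carrier G" "\<And>g. g \<in> carrier G \<Longrightarrow> g \<notin> F \<Longrightarrow> g [^] p = \<one>"
proof -
  interpret H: normal H G by fact
  have "\<exists>x. x \<in> carrier G - H"
    using two[OF two_is_prime_nat] by blast
  then have "H \<noteq> carrier G"
    by blast
  then obtain K q where K: "K \<lhd> G" "H \<subset> K" "derived G K \<subseteq> H" "Factorial_Ring.prime (q::nat)"
      "\<And>x. x \<in> K \<Longrightarrow> x [^] q \<in> H"
    using exists_exponent_layer[OF sol H _ primes] by metis
  interpret K: normal K G by fact
  have Kq: "k [^] q = \<one>" if "k \<in> K" "k \<notin> H" for k
    using that K by (intro prime_pow_eq_one_outside[OF H]) (auto intro: primes)
  \<comment> \<open>\<open>two\<close> supplies an element outside \<open>H\<close> whose order is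
    not \<open>q\<close>. It therefore lies outside \<open>K\<close> and acts as the outer element
    in the norm argument.\<close>
  obtain x0 where x0: "x0 \<in> carrier G" "x0 \<notin> H" "x0 [^] q \<noteq> \<one>"
    using two[OF K(4)] by blast
  then have x0K: "x0 \<notin> K"
    using Kq by blast
  obtain y where y: "y \<in> K" "y \<notin> H"
    using K(2) by blast
  \<comment> \<open>Descent along the derived series of \<open>H\<close>: the coset
    \<open>U y\<close> avoids \<open>H\<close>, because \<open>U\<close> lies in \<open>H\<close>
    and \<open>y\<close> does not, so \<open>Kq\<close> gives it exponent \<open>q\<close>.\<close>
  have "\<forall>k\<in>K. \<exists>n. k [^] (q ^ n) \<in> (derived G ^^ i) H" for i
  proof (induction i)
    case 0
    show ?case
      using K(5) by (metis funpow_0 power_one_right)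
  next
    case (Suc i)
    define U where "U = (derived G ^^ i) H"
    have U: "U \<lhd> G"
      unfolding U_def by (rule exp_of_derived_is_normal[OF H])
    have UH: "U \<subseteq> H"
      unfolding U_def by (induction i) (auto dest: derived_incl[OF _ H.subgroup_axioms])
    show ?case
    proof
      fix k assume k: "k \<in> K"
      then have kc: "k \<in> carrier G"
        by simp
      obtain n where n: "k [^] (q ^ n) \<in> U"
        using Suc k U_def by blast
      have "\<exists>m. (k [^] (q ^ n)) [^] (q ^ m) \<in> derived G U"
      proof (rule pow_mem_derived[OF fin U K(1) _ K(4) _ y(1) _ x0(1) x0K _ n])
        show "(u \<otimes> y) [^] q = \<one>" if u: "u \<in> U" for u
        proof (rule Kq)
          show "u \<otimes> y \<in> K"
            using u UH K(2) y by (intro K.m_closed) auto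
          show "u \<otimes> y \<notin> H"
            using subgroup_mult_mem_cancel[OF H.subgroup_axioms, of u y] u UH y by auto
        qed
      qed (use Suc U_def UH K(2) primes in auto)
      then obtain m where "k [^] (q ^ n * q ^ m) \<in> derived G U"
        using kc by (auto simp: nat_pow_pow)
      then have "k [^] (q ^ (n + m)) \<in> (derived G ^^ Suc i) H"
        by (simp add: power_add U_def)
      then show "\<exists>n. k [^] (q ^ n) \<in> (derived G ^^ Suc i) H" ..
    qed
  qed
  moreover obtain d where d: "(derived G ^^ d) (carrier G) = {\<one>}"
    using sol solvable_iff_trivial_derived_seq by blast
  then have trivial_D: "(derived G ^^ d) X \<subseteq> {\<one>}" if "X \<subseteq> carrier G" for X
    using mono_exp_of_derived[OF that, of d] by simp
  ultimately have K_pows: "\<exists>n. k [^] (q ^ n) = \<one>" if "k \<in> K" for k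
    using that H.subset by blast

  \<comment> \<open>The candidates are the normal \<open>q\<close>-subgroups containing
    \<open>K\<close>. Maximality of the chosen one is what later separates \<open>p\<close> from
    \<open>q\<close>.\<close>
  define \<F> where "\<F> = {F. F \<lhd> G \<and> K \<subseteq> F \<and> (\<forall>f\<in>F. \<exists>n. f [^] (q ^ n) = \<one>)}"
  have "finite \<F>"
  proof (rule finite_subset)
    show "\<F> \<subseteq> Pow (carrier G)"
      unfolding \<F>_def by (auto dest: normal_imp_subgroup subgroup.subset)
  qed (use fin in simp)
  moreover have "K \<in> \<F>"
    unfolding \<F>_def using K(1) K_pows by blast
  ultimately obtain F where "F \<in> \<F>" and F_max: "\<And>F'. F' \<in> \<F> \<Longrightarrow> F \<subseteq> F' \<Longrightarrow> F = F'"
    using finite_has_maximal[of \<F>] by blast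
  then have F: "F \<lhd> G" "K \<subseteq> F" "\<And>f. f \<in> F \<Longrightarrow> \<exists>n. f [^] (q ^ n) = \<one>"
    unfolding \<F>_def by auto
  interpret F: normal F G by fact
  have HF: "H \<subset> F"
    using K(2) F(2) by blast
  have primesF: "\<exists>s::nat. Factorial_Ring.prime s \<and> g [^] s = \<one>"
    if "g \<in> carrier G" "g \<notin> F" for g
    using that HF primes by blast
  \<comment> \<open>\<open>x0\<close> has prime order different from \<open>q\<close>, so no
    \<open>q\<close>-group contains it; hence \<open>F\<close> is proper.\<close>
  have "x0 \<notin> F"
  proof
    assume "x0 \<in> F"
    then obtain n where n: "x0 [^] (q ^ n) = \<one>"
      using F by blast
    obtain s :: nat where s: "Factorial_Ring.prime s" "x0 [^] s = \<one>"
      using primes x0 by blast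
    then have "s \<noteq> q"
      using x0 by blast
    then have "coprime (q ^ n) s"
      using s K(4) by (simp add: primes_coprime)
    then show False
      using mem_subgroup_if_coprime_pows[OF H.subgroup_axioms x0(1), of "q ^ n" s] n s x0(2) by simp
  qed
  then have "F \<noteq> carrier G"
    using x0 by blast
  then obtain M p where M: "M \<lhd> G" "F \<subset> M" "derived G M \<subseteq> F" "Factorial_Ring.prime (p::nat)"
      "\<And>x. x \<in> M \<Longrightarrow> x [^] p \<in> F"
    using exists_exponent_layer[OF sol F(1) _ primesF] by metis
  \<comment> \<open>With \<open>p = q\<close> the layer \<open>M\<close> would be a larger member of
    \<open>\<F>\<close>.\<close>
  have pq: "p \<noteq> q"
  proof
    assume pq: "p = q"
    have "\<exists>n. m [^] (q ^ n) = \<one>" if m: "m \<in> M" for m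
    proof -
      have mc: "m \<in> carrier G"
        using subgroup.mem_carrier[OF normal_imp_subgroup[OF M(1)] m] .
      obtain n where "(m [^] q) [^] (q ^ n) = \<one>"
        using F(3)[OF M(5)[OF m]] pq by auto
      then have "m [^] (q ^ Suc n) = \<one>"
        using mc by (simp add: nat_pow_pow)
      then show ?thesis ..
    qed
    then have "M \<in> \<F>"
      unfolding \<F>_def using M F by blast
    then show False
      using F_max M(2) by blast
  qed
  \<comment> \<open>Used for \<open>M\<close> and for \<open>F\<close> times
    \<open>generate G {x}\<close>. If \<open>N\<close> were proper, the norm argument for
    \<open>p\<close> would put some \<open>a [^] (p ^ n)\<close> into \<open>derived G F\<close> for
    each \<open>a\<close> in \<open>F\<close>; as \<open>a\<close> has \<open>q\<close>-power order,
    \<open>a\<close> itself lies there. A perfect \<open>F\<close> in a solvable group is trivial,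
    contradicting \<open>H \<subset> F\<close>.\<close>
  have whole: "N = carrier G" if N: "N \<lhd> G" "F \<subset> N" "\<And>x. x \<in> N \<Longrightarrow> x [^] p \<in> F" for N
  proof (rule ccontr)
    interpret N: normal N G by fact
    assume "N \<noteq> carrier G"
    then obtain x where x: "x \<in> carrier G" "x \<notin> N"
      using N.subset by blast
    obtain y where y: "y \<in> N" "y \<notin> F"
      using N by blast
    have "F \<subseteq> derived G F"
    proof
      fix a assume a: "a \<in> F"
      have "\<exists>n. a [^] (p ^ n) \<in> derived G F"
      proof (rule pow_mem_derived[OF fin F(1) N(1) _ M(4) _ y(1) _ x _ a])
        show "\<exists>n. k [^] (p ^ n) \<in> F" if "k \<in> N" for k
          using N(3)[OF that] by (metis power_one_right)
        show "(u \<otimes> y) [^] p = \<one>" if u: "u \<in> F" for u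
        proof (rule prime_pow_eq_one_outside[OF F(1) _ _ _ M(4) primesF])
          have uy: "u \<otimes> y \<in> N"
            using u N(2) y by (intro N.m_closed) auto
          then show "u \<otimes> y \<in> carrier G" "(u \<otimes> y) [^] p \<in> F"
            using N(3) by auto
          show "u \<otimes> y \<notin> F"
            using subgroup_mult_mem_cancel[OF F.subgroup_axioms, of u y] u y by auto
        qed
      qed (use N(2) primesF in auto)
      then obtain n where n: "a [^] (p ^ n) \<in> derived G F" ..
      obtain m where m: "a [^] (q ^ m) = \<one>"
        using F(3) a by blast
      have D: "subgroup (derived G F) G"
        by (rule derived_is_subgroup[OF F.subset])
      show "a \<in> derived G F"
        using mem_subgroup_if_coprime_pows[OF D _ n, of "q ^ m"] a m pq M(4) K(4)
          subgroup.one_closed[OF D] by (simp add: primes_coprime)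
    qed
    then have "F \<subseteq> (derived G ^^ i) F" for i
    proof (induction i)
      case (Suc i)
      then show ?case
        using mono_derived[OF Suc.IH] by fastforce
    qed simp
    then have "F \<subseteq> {\<one>}"
      using trivial_D[OF F.subset] by blast
    then show False
      using HF H.one_closed by blast
  qed
  have "M = carrier G"
    using whole[OF M(1,2)] M(5) by blast
  then have G_der: "derived G (carrier G) \<subseteq> F" and G_pow: "\<And>g. g \<in> carrier G \<Longrightarrow> g [^] p \<in> F"
    using M by auto
  obtain x where x: "x \<in> carrier G" "x \<notin> F"
    using M(2) \<open>M = carrier G\<close> by blast
  have x_sub: "subgroup (generate G {x}) G"
    using x by (intro generate_is_subgroup) simp
  interpret Fx: second_isomorphism_grp F G "generate G {x}"
    by (intro second_isomorphism_grp.intro F(1) second_isomorphism_grp_axioms.intro x_sub)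
  let ?N = "F <#> generate G {x}"
  interpret N: subgroup ?N G
    by (rule Fx.normal_set_mult_subgroup)
  have "?N = carrier G"
  proof (rule whole)
    show "?N \<lhd> G"
      unfolding normal_inv_iff
    proof (intro conjI ballI N.subgroup_axioms)
      fix g m assume g: "g \<in> carrier G" and m: "m \<in> ?N"
      then have mc: "m \<in> carrier G"
        by simp
      \<comment> \<open>\<open>G / F\<close> is abelian, so every subgroup containing
        \<open>F\<close> is normal.\<close>
      have "g \<otimes> m \<otimes> inv g \<otimes> inv m \<in> ?N"
        using commutator_mem_derived[OF g mc] G_der Fx.H_contained_in_set_mult by blast
      then have "(g \<otimes> m \<otimes> inv g \<otimes> inv m) \<otimes> m \<in> ?N"
        using m by (rule N.m_closed)
      then show "g \<otimes> m \<otimes> inv g \<in> ?N"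
        using g mc by (simp add: m_assoc)
    qed
    show "F \<subset> ?N"
      using Fx.H_contained_in_set_mult Fx.S_contained_in_set_mult x generate.incl[of x "{x}" G] by blast
  qed (use G_pow in simp)
  moreover have "g [^] p = \<one>" if "g \<in> carrier G" "g \<notin> F" for g
    using that G_pow M(4) by (intro prime_pow_eq_one_outside[OF F(1)] primesF)
  ultimately show ?thesis
    using that F(1) HF M(4) K(4) pq F(3) x by blast
qed

subsection \<open>Frobenius groups\<close>

text \<open>In an abelian group \<open>r\<close>-th powers form a homomorphism. If \<open>h\<close>
  is outside its kernel and \<open>g\<close> inside, then \<open>h \<otimes> g\<close> is outside,
  so \<open>g\<close> is a quotient of two generators. This later excludes an abelian Frobenius
  kernel.\<close>

lemma (in comm_group) hughes_trivial_or_whole: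
  "hughes G r = {\<one>} \<or> hughes G r = carrier G"
proof (cases "\<exists>h\<in>carrier G. h [^] r \<noteq> \<one>")
  case True
  then obtain h where h: "h \<in> carrier G" "h [^] r \<noteq> \<one>"
    by blast
  have sub: "subgroup (hughes G r) G"
    unfolding hughes_def by (intro generate_is_subgroup) blast
  have gen: "g \<in> hughes G r" if "g \<in> carrier G" "g [^] r \<noteq> \<one>" for g
    unfolding hughes_def using that by (intro generate.incl) simp
  have "g \<in> hughes G r" if g: "g \<in> carrier G" for g
  proof (cases "g [^] r = \<one>")
    case True
    then have "(h \<otimes> g) [^] r \<noteq> \<one>"
      using h g by (simp add: nat_pow_distrib)
    then show ?thesis
      using subgroup_mult_mem_cancel[OF sub gen[OF h] g] gen[of "h \<otimes> g"] h g by simp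
  qed (use gen g in blast)
  then show ?thesis
    using subgroup.subset[OF sub] by blast
next
  case False
  then have "{g \<in> carrier G. g [^] r \<noteq> \<one>} = {}"
    by blast
  then show ?thesis
    unfolding hughes_def by (simp only: generate_empty simp_thms)
qed

section \<open>From a splitting to a Frobenius group\<close>

lemma (in group) conj_coset_eq:
  assumes "P \<subseteq> carrier G" "g \<in> carrier G"
  shows "g <# (P #> inv g) = (\<lambda>h. g \<otimes> h \<otimes> inv g) ` P"
  using assms by (auto simp: l_coset_def r_coset_def m_assoc subset_iff)

lemma (in group) conj_nat_pow:
  assumes "g \<in> carrier G" "h \<in> carrier G"
  shows "(g \<otimes> h \<otimes> inv g) [^] (n::nat) = g \<otimes> h [^] n \<otimes> inv g"
  using assms by (induction n) (auto simp: m_assoc inv_mult_cancel)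

text \<open>For \<open>f\<close> in \<open>F\<close> and \<open>z\<close> nontrivial in the group
  generated by \<open>x\<close>, the product \<open>f z\<close> lies outside \<open>F\<close> and is
  killed by \<open>p\<close>. If \<open>f\<close> and \<open>z\<close> commute, \<open>f\<close> is
  killed by \<open>p\<close> and by a power of \<open>q\<close>, hence trivial. This
  fixed-point-freeness yields both the complement condition and the kernel.\<close>

lemma (in group) frobenius_group_of_splitting:
  assumes fin: "finite (carrier G)" and F: "F \<lhd> G" "F \<noteq> {\<one>}"
    and pq: "Factorial_Ring.prime (p::nat)" "Factorial_Ring.prime (q::nat)" "p \<noteq> q"
    and F_pows: "\<And>f. f \<in> F \<Longrightarrow> \<exists>n. f [^] (q ^ n) = \<one>"
    and x: "x \<in> carrier G" "x \<notin> F" "F <#> generate G {x} = carrier G"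
    and outside: "\<And>g. g \<in> carrier G \<Longrightarrow> g \<notin> F \<Longrightarrow> g [^] p = \<one>"
  shows "frobenius_group G F (generate G {x})" "card (generate G {x}) = p"
proof -
  interpret F: normal F G by fact
  define P where "P = generate G {x}"
  interpret P: subgroup P G
    unfolding P_def using x(1) by (intro generate_is_subgroup) simp
  have xP: "x \<in> P"
    unfolding P_def by (intro generate.incl) simp
  have x1: "x \<noteq> \<one>"
    using x(2) F.one_closed by blast
  have P_pows: "\<exists>i::nat. z = x [^] i" if "z \<in> P" for z
    using that generate_pow_on_finite_carrier[OF fin x(1)] unfolding P_def by blast
  have xp: "x [^] p = \<one>"
    by (rule outside[OF x(1,2)])
  show "card (generate G {x}) = p"
  proof -
    have "ord x dvd p"
      using xp x(1) pow_eq_id by blast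
    then have "ord x = p"
      using pq(1) x1 ord_eq_1[OF x(1)] unfolding prime_nat_iff by blast
    then show ?thesis
      using generate_pow_card[OF x(1)] by simp
  qed
  have split: "\<exists>f\<in>F. \<exists>z\<in>P. g = f \<otimes> z" if "g \<in> carrier G" for g
    using that unfolding x(3)[symmetric] P_def set_mult_def by auto
  \<comment> \<open>A power \<open>x [^] i\<close> in \<open>F\<close> with \<open>i\<close> coprime
    to \<open>p\<close> would put \<open>x\<close> into \<open>F\<close>.\<close>
  have inter: "z = \<one>" if z: "z \<in> F" "z \<in> P" for z
  proof -
    obtain i :: nat where i: "z = x [^] i"
      using P_pows z by blast
    have "\<not> coprime i p"
      using mem_subgroup_if_coprime_pows[OF F.subgroup_axioms x(1), of i p] z(1) i xp x(2) by auto
    then have "p dvd i"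
      using pq(1) by (metis coprime_commute prime_imp_coprime)
    then obtain k where "i = p * k" ..
    then have "z = (x [^] p) [^] k"
      using i x(1) by (simp add: nat_pow_pow)
    then show ?thesis
      using xp by simp
  qed
  have commuting: "f = \<one>" if f: "f \<in> F" and z: "z \<in> P" "z \<noteq> \<one>" and comm: "f \<otimes> z = z \<otimes> f" for f z
  proof -
    have "z \<notin> F"
      using inter z by blast
    then have "f \<otimes> z \<notin> F"
      using subgroup_mult_mem_cancel[OF F.subgroup_axioms f P.mem_carrier[OF z(1)]] by blast
    then have "(f \<otimes> z) [^] p = \<one>" "z [^] p = \<one>"
      using outside f z \<open>z \<notin> F\<close> by auto
    then have fp: "f [^] p = \<one>"
      using pow_mult_distrib[OF comm, of p] f z by simp
    obtain n where "f [^] (q ^ n) = \<one>"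
      using F_pows f by blast
    then have "f \<in> {\<one>}"
      using mem_subgroup_if_coprime_pows[OF triv_subgroup, of f p "q ^ n"] fp f pq
      by (simp add: primes_coprime)
    then show ?thesis
      by simp
  qed
  have P_comm: "z \<otimes> w = w \<otimes> z" if zw: "z \<in> P" "w \<in> P" for z w
  proof -
    obtain i j :: nat where "z = x [^] i" "w = x [^] j"
      using P_pows zw by metis
    then show ?thesis
      using x(1) by (simp add: nat_pow_mult add.commute)
  qed
  have compl: "frobenius_complement G P"
    unfolding frobenius_complement_def
  proof (intro conjI ballI P.subgroup_axioms)
    show "P \<noteq> {\<one>}"
      using xP x1 by blast
    show "P \<noteq> carrier G"
    proof
      assume "P = carrier G"
      then have "F \<subseteq> {\<one>}"
        using inter F.subset by blast
      then show False
        using F(2) F.one_closed by blast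
    qed
    fix g assume g: "g \<in> carrier G - P"
    then obtain f z where fz: "f \<in> F" "z \<in> P" "g = f \<otimes> z"
      using split by blast
    have trivial: "w = \<one>" if w: "w \<in> P" "g \<otimes> w \<otimes> inv g \<in> P" for w
    proof (rule ccontr)
      assume w1: "w \<noteq> \<one>"
      \<comment> \<open>\<open>P\<close> is cyclic, so \<open>z\<close> centralises
        \<open>w\<close>, and conjugation by \<open>g\<close> reduces to conjugation by its
        \<open>F\<close>-part \<open>f\<close>.\<close>
      have zw: "z \<otimes> w \<otimes> inv z = w"
        using P_comm[OF fz(2) w(1)] fz w by (simp add: m_assoc)
      have "g \<otimes> w \<otimes> inv g = f \<otimes> (z \<otimes> w \<otimes> inv z) \<otimes> inv f"
        using fz w by (simp add: m_assoc inv_mult_group)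
      then have gw: "g \<otimes> w \<otimes> inv g = f \<otimes> w \<otimes> inv f"
        unfolding zw .
      \<comment> \<open>The commutator of \<open>f\<close> and \<open>w\<close> lies in
        \<open>F\<close> by normality and in \<open>P\<close> by the choice of \<open>w\<close>, so
        it is trivial.\<close>
      have "f \<otimes> (w \<otimes> inv f \<otimes> inv w) \<in> F"
        using fz w by (intro F.m_closed F.inv_op_closed2) auto
      then have "g \<otimes> w \<otimes> inv g \<otimes> inv w \<in> F"
        unfolding gw using fz w by (simp add: m_assoc)
      moreover have "g \<otimes> w \<otimes> inv g \<otimes> inv w \<in> P"
        using w by auto
      ultimately have "f \<otimes> w \<otimes> inv f \<otimes> inv w = \<one>"
        using inter unfolding gw by blast
      then have "f \<otimes> w = w \<otimes> f"
        using fz w by (metis F.mem_carrier P.mem_carrier inv_closed inv_equality inv_inv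
            m_closed inv_solve_right')
      then have "f = \<one>"
        using commuting fz w w1 by blast
      then show False
        using g fz by simp
    qed
    have "P \<inter> (\<lambda>h. g \<otimes> h \<otimes> inv g) ` P \<subseteq> {\<one>}"
    proof clarify
      fix w assume "w \<in> P" "g \<otimes> w \<otimes> inv g \<in> P"
      then have "w = \<one>"
        by (rule trivial)
      then show "g \<otimes> w \<otimes> inv g = \<one>"
        using g by simp
    qed
    moreover have "\<one> \<in> (\<lambda>h. g \<otimes> h \<otimes> inv g) ` P"
      using g P.one_closed by (intro image_eqI[of _ _ \<one>]) auto
    ultimately have "P \<inter> (\<lambda>h. g \<otimes> h \<otimes> inv g) ` P = {\<one>}"
      using P.one_closed by blast
    then show "P \<inter> (g <# (P #> inv g)) = {\<one>}"
      using conj_coset_eq[OF P.subset, of g] g by simp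
  qed
  have conjugate: "\<exists>k\<in>carrier G. g \<in> (\<lambda>h. k \<otimes> h \<otimes> inv k) ` P" if g: "g \<in> carrier G" "g \<notin> F" for g
  proof -
    obtain f z where fz: "f \<in> F" "z \<in> P" "g = f \<otimes> z"
      using split g by blast
    then have z1: "z \<noteq> \<one>"
      using g by auto
    \<comment> \<open>Fixed-point-freeness makes \<open>?c\<close> injective on the finite set
      \<open>F\<close>, hence surjective. Writing \<open>f = ?c k\<close> turns
      \<open>g = f z\<close> into the conjugate \<open>k z k^-1\<close>.\<close>
    let ?c = "\<lambda>k. k \<otimes> z \<otimes> inv k \<otimes> inv z"
    have c_F: "?c k \<in> F" if "k \<in> F" for k
    proof -
      have "k \<otimes> (z \<otimes> inv k \<otimes> inv z) \<in> F"
        using that fz by (intro F.m_closed F.inv_op_closed2) auto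
      then show ?thesis
        using that fz by (simp add: m_assoc)
    qed
    have "inj_on ?c F"
    proof (rule inj_onI)
      fix k l assume kl: "k \<in> F" "l \<in> F" "?c k = ?c l"
      then have "k \<otimes> z \<otimes> inv k = l \<otimes> z \<otimes> inv l"
        using fz by simp
      then have "inv l \<otimes> (k \<otimes> z \<otimes> inv k) \<otimes> k = inv l \<otimes> (l \<otimes> z \<otimes> inv l) \<otimes> k"
        by simp
      then have "(inv l \<otimes> k) \<otimes> z = z \<otimes> (inv l \<otimes> k)"
        using kl fz by (simp add: m_assoc inv_mult_cancel)
      then have "inv l \<otimes> k = \<one>"
        using commuting[of "inv l \<otimes> k" z] kl fz z1 by blast
      then show "k = l"
        using kl by (metis F.mem_carrier inv_closed inv_equality inv_inv)
    qed
    then have "?c ` F = F"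
      using c_F fin F.subset finite_subset by (intro endo_inj_surj) blast+
    then obtain k where k: "k \<in> F" "f = ?c k"
      using fz(1) by blast
    then have "g = k \<otimes> z \<otimes> inv k"
      using fz by (simp add: m_assoc)
    then have "g \<in> (\<lambda>h. k \<otimes> h \<otimes> inv k) ` P"
      using fz(2) by (rule image_eqI)
    then show ?thesis
      using F.mem_carrier[OF k(1)] by (rule bexI)
  qed
  have kernel: "F = frobenius_kernel G P"
  proof (intro equalityI subsetI)
    fix f assume f: "f \<in> F"
    have "f = \<one>" if k: "k \<in> carrier G" and fk: "f \<in> k <# (P #> inv k)" for k
    proof -
      obtain h where h: "h \<in> P" "f = k \<otimes> h \<otimes> inv k"
        using fk conj_coset_eq[OF P.subset k] by auto
      then have "inv k \<otimes> f \<otimes> k = h"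
        using k by (simp add: m_assoc inv_mult_cancel)
      then have "h \<in> F"
        using F.inv_op_closed1[OF k f] by simp
      then have "h = \<one>"
        using inter h(1) by blast
      then show ?thesis
        using h k by simp
    qed
    then show "f \<in> frobenius_kernel G P"
      unfolding frobenius_kernel_def using f by auto
  next
    fix f assume "f \<in> frobenius_kernel G P"
    then have f: "f = \<one> \<or> f \<in> carrier G \<and> (\<forall>k\<in>carrier G. f \<notin> (\<lambda>h. k \<otimes> h \<otimes> inv k) ` P)"
      unfolding frobenius_kernel_def using conj_coset_eq[OF P.subset] by auto
    show "f \<in> F"
      using f conjugate F.one_closed by blast
  qed
  show "frobenius_group G F (generate G {x})"
    unfolding frobenius_group_def using compl kernel by (simp add: P_def)
qed

section \<open>Elementwise consequences of the Frobenius condition\<close>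

text \<open>Here \<open>F\<close> is known only as a set, the identity together with all elements
  outside the conjugates of \<open>P\<close>. It is invariant under conjugation because the union of
  these conjugates is.\<close>

lemma (in group) frobenius_kernel_facts:
  assumes "frobenius_group G F P"
  shows "subgroup P G" "F \<subseteq> carrier G" "F \<inter> P = {\<one>}" "P \<noteq> {\<one>}"
    and "\<And>g f. g \<in> carrier G \<Longrightarrow> f \<in> F \<Longrightarrow> g \<otimes> f \<otimes> inv g \<in> F"
    and "\<And>g. g \<in> carrier G \<Longrightarrow> g \<notin> F \<Longrightarrow> \<exists>k\<in>carrier G. \<exists>h\<in>P. g = k \<otimes> h \<otimes> inv k"
    and "\<And>g h. g \<in> carrier G \<Longrightarrow> g \<notin> P \<Longrightarrow> h \<in> P \<Longrightarrow> g \<otimes> h \<otimes> inv g \<in> P \<Longrightarrow> h = \<one>"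
proof -
  have compl: "frobenius_complement G P" and F: "F = frobenius_kernel G P"
    using assms by (auto simp: frobenius_group_def)
  show P: "subgroup P G" "P \<noteq> {\<one>}"
    using compl by (auto simp: frobenius_complement_def)
  interpret P: subgroup P G
    by (rule P)
  have F_iff: "f \<in> F \<longleftrightarrow> f = \<one> \<or> f \<in> carrier G \<and> (\<forall>k\<in>carrier G. f \<notin> (\<lambda>h. k \<otimes> h \<otimes> inv k) ` P)" for f
    unfolding F frobenius_kernel_def using conj_coset_eq[OF P.subset] by auto
  show FG: "F \<subseteq> carrier G"
    using F_iff by auto
  show "\<exists>k\<in>carrier G. \<exists>h\<in>P. g = k \<otimes> h \<otimes> inv k" if "g \<in> carrier G" "g \<notin> F" for g
    using that F_iff by blast
  show "F \<inter> P = {\<one>}"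
  proof (intro equalityI subsetI)
    fix z assume z: "z \<in> F \<inter> P"
    \<comment> \<open>Conjugation by the identity shows that \<open>P\<close> itself is among the
      conjugates removed from \<open>F\<close>.\<close>
    then have "z \<in> (\<lambda>h. \<one> \<otimes> h \<otimes> inv \<one>) ` P"
      by (intro image_eqI[of _ _ z]) auto
    then show "z \<in> {\<one>}"
      using z F_iff[of z] by blast
  qed (use F_iff in auto)
  show "h = \<one>" if g: "g \<in> carrier G" "g \<notin> P" and h: "h \<in> P" "g \<otimes> h \<otimes> inv g \<in> P" for g h
  proof -
    have "P \<inter> (g <# (P #> inv g)) = {\<one>}"
      using compl g unfolding frobenius_complement_def by blast
    then have "P \<inter> (\<lambda>h. g \<otimes> h \<otimes> inv g) ` P = {\<one>}"
      unfolding conj_coset_eq[OF P.subset g(1)] .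
    then have "g \<otimes> h \<otimes> inv g = \<one>"
      using h by blast
    then have "inv g \<otimes> (g \<otimes> h \<otimes> inv g) \<otimes> g = inv g \<otimes> \<one> \<otimes> g"
      by (rule arg_cong)
    then show ?thesis
      using g h by (simp add: m_assoc inv_mult_cancel)
  qed
  show "g \<otimes> f \<otimes> inv g \<in> F" if g: "g \<in> carrier G" and f: "f \<in> F" for g f
  proof (rule ccontr)
    have fc: "f \<in> carrier G"
      using FG f by blast
    assume "g \<otimes> f \<otimes> inv g \<notin> F"
    then have ne: "g \<otimes> f \<otimes> inv g \<noteq> \<one>"
      and "\<exists>k\<in>carrier G. g \<otimes> f \<otimes> inv g \<in> (\<lambda>h. k \<otimes> h \<otimes> inv k) ` P"
      using F_iff[of "g \<otimes> f \<otimes> inv g"] g fc by auto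
    then obtain k h where kh: "k \<in> carrier G" "h \<in> P" "g \<otimes> f \<otimes> inv g = k \<otimes> h \<otimes> inv k"
      by blast
    have "f = inv g \<otimes> (g \<otimes> f \<otimes> inv g) \<otimes> g"
      using g fc by (simp add: m_assoc inv_mult_cancel)
    also have "\<dots> = (inv g \<otimes> k) \<otimes> h \<otimes> inv (inv g \<otimes> k)"
      unfolding kh(3) using g kh(1,2) by (simp add: m_assoc inv_mult_group)
    finally have "f \<in> (\<lambda>h. (inv g \<otimes> k) \<otimes> h \<otimes> inv (inv g \<otimes> k)) ` P"
      using kh(2) by (rule image_eqI)
    then have "f = \<one>"
      using F_iff[of f] f g kh(1) m_closed inv_closed by blast
    then show False
      using ne g by simp
  qed
qed

text \<open>Conjugation by the complement is a free action on the nontrivial elements of the kernel.\<close>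
lemma (in group) card_complement_dvd_card_kernel_minus_one:
  assumes fin: "finite (carrier G)" and frob: "frobenius_group G F P"
  shows "card P dvd card (F - {\<one>})"
proof -
  note facts = frobenius_kernel_facts[OF frob]
  interpret P: subgroup P G
    by (rule facts)
  \<comment> \<open>The classes of \<open>r\<close> are the orbits of \<open>P\<close>; each turns
    out to have \<open>card P\<close> elements.\<close>
  define r where "r = {(f, g). f \<in> F - {\<one>} \<and> (\<exists>z\<in>P. g = z \<otimes> f \<otimes> inv z)}"
  have FG: "f \<in> carrier G" if "f \<in> F" for f
    using that facts(2) by blast
  have cl: "z \<otimes> f \<otimes> inv z \<in> F - {\<one>}" if "f \<in> F - {\<one>}" "z \<in> P" for z f
  proof -
    have "z \<otimes> f \<otimes> inv z \<noteq> \<one>"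
    proof
      assume "z \<otimes> f \<otimes> inv z = \<one>"
      then have "inv z \<otimes> (z \<otimes> f \<otimes> inv z) \<otimes> z = inv z \<otimes> \<one> \<otimes> z"
        by (rule arg_cong)
      then show False
        using that FG by (simp add: m_assoc inv_mult_cancel)
    qed
    then show ?thesis
      using facts(5)[of z f] that by simp
  qed
  have "equiv (F - {\<one>}) r"
  proof (rule equivI)
    show "r \<subseteq> (F - {\<one>}) \<times> (F - {\<one>})"
    proof (rule subrelI)
      fix f g assume "(f, g) \<in> r"
      then obtain z where "f \<in> F - {\<one>}" "z \<in> P" "g = z \<otimes> f \<otimes> inv z"
        unfolding r_def by blast
      then show "(f, g) \<in> (F - {\<one>}) \<times> (F - {\<one>})"
        using cl[of f z] by (simp only: mem_Sigma_iff simp_thms)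
    qed
    show "refl_on (F - {\<one>}) r"
    proof (rule refl_onI)
      fix f assume f: "f \<in> F - {\<one>}"
      then have "f = \<one> \<otimes> f \<otimes> inv \<one>"
        using FG by simp
      then show "(f, f) \<in> r"
        unfolding r_def using f P.one_closed by blast
    qed
    show "sym r"
    proof (rule symI)
      fix f g assume "(f, g) \<in> r"
      then obtain z where z: "f \<in> F - {\<one>}" "z \<in> P" "g = z \<otimes> f \<otimes> inv z"
        unfolding r_def by blast
      then have "f = inv z \<otimes> g \<otimes> inv (inv z)"
        using FG by (simp add: m_assoc inv_mult_cancel)
      moreover have "g \<in> F - {\<one>}" "inv z \<in> P"
        using cl z by auto
      ultimately show "(g, f) \<in> r"
        unfolding r_def by blast
    qed
    show "trans r"
    proof (rule transI)
      fix f g h assume "(f, g) \<in> r" "(g, h) \<in> r"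
      then obtain z w where z: "f \<in> F - {\<one>}" "z \<in> P" "g = z \<otimes> f \<otimes> inv z"
        and w: "w \<in> P" "h = w \<otimes> g \<otimes> inv w"
        unfolding r_def by blast
      then have "h = (w \<otimes> z) \<otimes> f \<otimes> inv (w \<otimes> z)"
        using FG by (simp add: m_assoc inv_mult_group)
      then show "(f, h) \<in> r"
        unfolding r_def using z w P.m_closed by blast
    qed
  qed
  then show ?thesis
  proof (rule equiv_imp_dvd_card[rotated])
    show "finite (F - {\<one>})"
      using fin facts(2) finite_subset by blast
    fix X assume "X \<in> (F - {\<one>}) // r"
    then obtain f where f: "f \<in> F - {\<one>}" "X = r `` {f}"
      by (rule quotientE)
    have fP: "f \<notin> P"
      using f facts(3) by blast
    have "X = (\<lambda>z. z \<otimes> f \<otimes> inv z) ` P"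
      using f unfolding r_def by auto
    moreover have "inj_on (\<lambda>z. z \<otimes> f \<otimes> inv z) P"
    proof (rule inj_onI)
      fix z w assume zw: "z \<in> P" "w \<in> P" "z \<otimes> f \<otimes> inv z = w \<otimes> f \<otimes> inv w"
      define u where "u = inv w \<otimes> z"
      have u: "u \<in> P" "u \<in> carrier G"
        unfolding u_def using zw by auto
      \<comment> \<open>\<open>u\<close> commutes with \<open>f\<close>. Read the other way,
        \<open>f\<close> lies outside \<open>P\<close> and conjugates \<open>u\<close> into
        \<open>P\<close>, so \<open>facts(7)\<close> makes \<open>u\<close> trivial.\<close>
      have "u \<otimes> f = inv w \<otimes> (z \<otimes> f \<otimes> inv z) \<otimes> z"
        unfolding u_def using zw(1,2) f FG by (simp add: m_assoc)
      also have "\<dots> = f \<otimes> u"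
        unfolding u_def zw(3) using zw(1,2) f FG by (simp add: m_assoc inv_mult_cancel)
      finally have "f \<otimes> u \<otimes> inv f = u"
        using u f FG by (metis DiffD1 inv_solve_right m_closed)
      then have "u = \<one>"
        using facts(7)[of f u] fP u f FG by simp
      then show "z = w"
        unfolding u_def using zw by (metis P.mem_carrier inv_closed inv_equality inv_inv)
    qed
    ultimately show "card P dvd card X"
      using card_image by fastforce
  qed
qed

subsection \<open>Hughes subgroups\<close>

text \<open>Elements outside \<open>F\<close> are conjugate into \<open>P\<close> and so killed by
  \<open>card P\<close>, while a nontrivial element of the \<open>q\<close>-group \<open>F\<close>
  can be killed by no prime other than \<open>q\<close>. Hence both Hughes subgroups have the same
  generators.\<close>

lemma (in group) frobenius_prime_complement:
  assumes fin: "finite (carrier G)" and frob: "frobenius_group G F P"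
    and q: "Factorial_Ring.prime q" "finite_p_group q (G\<lparr>carrier := F\<rparr>)" "F \<noteq> {\<one>}"
    and p: "Factorial_Ring.prime (card P)"
  shows "{x \<in> carrier G. \<forall>r\<in>prime_divisors_group G. x [^] r \<noteq> \<one>} = {x \<in> F. x [^] q \<noteq> \<one>}"
    and "hughes_set G (prime_divisors_group G) = hughes (G\<lparr>carrier := F\<rparr>) q"
    and "hughes (G\<lparr>carrier := F\<rparr>) q \<subset> F \<Longrightarrow> r \<in> prime_divisors_group G \<Longrightarrow>
      hughes_set G (prime_divisors_group G) \<subset> hughes G r"
proof -
  note facts = frobenius_kernel_facts[OF frob]
  \<comment> \<open>Closure of \<open>F\<close> under the operations is read off from
    \<open>finite_p_group\<close>, which asserts that \<open>F\<close> carries a group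
    structure.\<close>
  have F: "subgroup F G"
    using q(2) facts(2) unfolding finite_p_group_def by (intro group_incl_imp_subgroup) auto
  interpret F: subgroup F G
    by (rule F)
  interpret P: subgroup P G
    by (rule facts)
  interpret FG: group "G\<lparr>carrier := F\<rparr>"
    by (rule subgroup_imp_group[OF F])
  have finF: "finite F" and finP: "finite P"
    using fin F.subset P.subset finite_subset by blast+
  obtain n where n: "card F = q ^ n"
    using q(2) unfolding finite_p_group_def order_def by auto
  have "card F \<noteq> 1"
    using q(3) F.one_closed by (metis card_1_singletonE singletonD)
  then have n0: "n > 0"
    using n by (cases n) auto
  have F_pow: "f [^] (q ^ n) = \<one>" if "f \<in> F" for f
    using FG.pow_order_eq_1[of f] that finF n by (simp add: order_def nat_pow_consistent[symmetric])
  have P_pow: "h [^] card P = \<one>" if "h \<in> P" for h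
  proof -
    interpret PG: group "G\<lparr>carrier := P\<rparr>"
      by (rule subgroup_imp_group[OF P.subgroup_axioms])
    show ?thesis
      using PG.pow_order_eq_1[of h] that finP by (simp add: order_def nat_pow_consistent[symmetric])
  qed
  have q_mem: "q \<in> prime_divisors_group G"
  proof -
    have "q dvd card F"
      using n n0 by (simp add: dvd_power)
    then have "q dvd order G"
      using lagrange[OF F] by (metis dvd_mult)
    then show ?thesis
      using q(1) by (simp add: prime_divisors_group_def)
  qed
  have p_mem: "card P \<in> prime_divisors_group G"
    using p lagrange[OF P.subgroup_axioms] unfolding prime_divisors_group_def
    by (metis (mono_tags) dvd_triv_right mem_Collect_eq)
  have outside: "g [^] card P = \<one>" if g: "g \<in> carrier G" "g \<notin> F" for g
  proof -
    obtain k h where kh: "k \<in> carrier G" "h \<in> P" "g = k \<otimes> h \<otimes> inv k"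
      using facts(6)[OF g] by blast
    then show ?thesis
      using conj_nat_pow[of k h "card P"] P_pow[of h] by simp
  qed
  show S_eq: "{x \<in> carrier G. \<forall>r\<in>prime_divisors_group G. x [^] r \<noteq> \<one>} = {x \<in> F. x [^] q \<noteq> \<one>}"
  proof (intro equalityI subsetI)
    fix x assume "x \<in> {x \<in> carrier G. \<forall>r\<in>prime_divisors_group G. x [^] r \<noteq> \<one>}"
    then have x: "x \<in> carrier G" "x [^] q \<noteq> \<one>" "x [^] card P \<noteq> \<one>"
      using q_mem p_mem by auto
    then show "x \<in> {x \<in> F. x [^] q \<noteq> \<one>}"
      using outside by blast
  next
    fix x assume "x \<in> {x \<in> F. x [^] q \<noteq> \<one>}"
    then have x: "x \<in> F" "x \<in> carrier G" "x [^] q \<noteq> \<one>"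
      by auto
    have "x [^] r \<noteq> \<one>" if r: "r \<in> prime_divisors_group G" for r
    proof
      assume xr: "x [^] r = \<one>"
      then have "r \<noteq> q"
        using x by blast
      then have "coprime r (q ^ n)"
        using r q(1) by (simp add: prime_divisors_group_def primes_coprime)
      then have "x \<in> {\<one>}"
        using mem_subgroup_if_coprime_pows[OF triv_subgroup x(2), of r "q ^ n"] xr F_pow[OF x(1)]
        by simp
      then show False
        using x(3) by simp
    qed
    then show "x \<in> {x \<in> carrier G. \<forall>r\<in>prime_divisors_group G. x [^] r \<noteq> \<one>}"
      using x(2) by blast
  qed
  have hughes_F: "hughes (G\<lparr>carrier := F\<rparr>) q = generate G {x \<in> F. x [^] q \<noteq> \<one>}"
    unfolding hughes_def using generate_consistent[OF _ F, of "{x \<in> F. x [^] q \<noteq> \<one>}"]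
    by (simp add: nat_pow_consistent[symmetric])
  show eq: "hughes_set G (prime_divisors_group G) = hughes (G\<lparr>carrier := F\<rparr>) q"
    unfolding hughes_F hughes_set_def S_eq ..
  have hughes_sub: "hughes (G\<lparr>carrier := F\<rparr>) q \<subseteq> F"
    unfolding hughes_F by (intro generate_subgroup_incl F) blast
  \<comment> \<open>\<open>card P\<close> divides \<open>card F - 1\<close> by the free action,
    while \<open>q\<close> divides \<open>card F\<close>.\<close>
  have pq: "card P \<noteq> q"
  proof
    assume pq: "card P = q"
    have "card (F - {\<one>}) + 1 = card F"
      using finF F.one_closed card_Suc_Diff1[of F \<one>] by simp
    moreover have "q dvd card (F - {\<one>})"
      using card_complement_dvd_card_kernel_minus_one[OF fin frob] pq by simp
    moreover have "q dvd card F"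
      using n n0 by (simp add: dvd_power)
    ultimately have "q dvd 1"
      by (metis dvd_add_right_iff)
    then show False
      using q(1) not_prime_unit by blast
  qed
  assume proper: "hughes (G\<lparr>carrier := F\<rparr>) q \<subset> F" and r: "r \<in> prime_divisors_group G"
  have "hughes_set G (prime_divisors_group G) \<subseteq> hughes G r"
    unfolding hughes_set_def hughes_def using r by (intro mono_generate) blast
  moreover have "\<exists>x\<in>carrier G. x \<notin> hughes_set G (prime_divisors_group G) \<and> x [^] r \<noteq> \<one>"
  \<comment> \<open>For \<open>r = card P\<close> the witness is an element of the
    \<open>q\<close>-group \<open>F\<close> outside its Hughes subgroup; for any other
    \<open>r\<close> it is a nontrivial element of \<open>P\<close>, which lies outside
    \<open>F\<close> altogether.\<close>
  proof (cases "r = card P")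
    case True
    obtain f where f: "f \<in> F" "f \<notin> hughes (G\<lparr>carrier := F\<rparr>) q"
      using proper by blast
    have "\<one> \<in> hughes (G\<lparr>carrier := F\<rparr>) q"
      unfolding hughes_F by (rule generate.one)
    then have f1: "f \<noteq> \<one>"
      using f by blast
    have "coprime r (q ^ n)"
      using True p q(1) pq by (simp add: primes_coprime)
    then have "f [^] r \<noteq> \<one>"
      using mem_subgroup_if_coprime_pows[OF triv_subgroup, of f r "q ^ n"] F_pow f f1 by auto
    then show ?thesis
      using f eq by auto
  next
    case False
    obtain h where h: "h \<in> P" "h \<noteq> \<one>"
      using facts(4) P.one_closed by blast
    have "coprime r (card P)"
      using False p r by (simp add: prime_divisors_group_def primes_coprime)
    then have "h [^] r \<noteq> \<one>"
      using mem_subgroup_if_coprime_pows[OF triv_subgroup, of h r "card P"] P_pow h by auto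
    moreover have "h \<notin> F"
      using facts(3) h by blast
    ultimately show ?thesis
      using h eq hughes_sub by auto
  qed
  then have "\<exists>x. x \<in> hughes G r \<and> x \<notin> hughes_set G (prime_divisors_group G)"
    unfolding hughes_def by (blast intro: generate.incl)
  ultimately show "hughes_set G (prime_divisors_group G) \<subset> hughes G r"
    by blast
qed

section \<open>From strict containments to the Frobenius structure\<close>

lemma (in group) hughes_set_normal: "hughes_set G \<rho> \<lhd> G"
  unfolding hughes_set_def
proof (rule normal_generateI)
  fix h g assume h: "h \<in> {x \<in> carrier G. \<forall>r\<in>\<rho>. x [^] r \<noteq> \<one>}" and g: "g \<in> carrier G"
  have "(g \<otimes> h \<otimes> inv g) [^] r \<noteq> \<one>" if "r \<in> \<rho>" for r
  proof
    assume "(g \<otimes> h \<otimes> inv g) [^] r = \<one>"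
    then have "g \<otimes> h [^] r \<otimes> inv g = \<one>"
      using conj_nat_pow g h by simp
    then have "inv g \<otimes> (g \<otimes> h [^] r \<otimes> inv g) \<otimes> g = inv g \<otimes> \<one> \<otimes> g"
      by (rule arg_cong)
    then have "h [^] r = \<one>"
      using g h by (simp add: m_assoc inv_mult_cancel)
    then show False
      using h that by blast
  qed
  then show "g \<otimes> h \<otimes> inv g \<in> {x \<in> carrier G. \<forall>r\<in>\<rho>. x [^] r \<noteq> \<one>}"
    using g h by simp
qed blast

text \<open>The strict containments become the hypothesis \<open>two\<close> of the splitting, which
  produces \<open>F\<close>. Its Hughes subgroup turns out to be \<open>H\<close>, strictly between
  the identity and \<open>F\<close>, so the dichotomy for abelian groups rules out a commutative
  \<open>F\<close>.\<close>

lemma (in group) frobenius_if_hughes_set_proper: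
  assumes fin: "finite (carrier G)" and sol: "solvable G"
    and nontriv: "{\<one>} \<subset> hughes_set G (prime_divisors_group G)"
    and proper: "\<And>p. p \<in> prime_divisors_group G \<Longrightarrow>
      hughes_set G (prime_divisors_group G) \<subset> hughes G p"
  shows "\<exists>F P q. frobenius_group G F P \<and> Factorial_Ring.prime q \<and>
         finite_p_group q (G\<lparr>carrier := F\<rparr>) \<and> \<not> comm_group (G\<lparr>carrier := F\<rparr>) \<and>
         {\<one>} \<subset> hughes (G\<lparr>carrier := F\<rparr>) q \<and> hughes (G\<lparr>carrier := F\<rparr>) q \<subset> F \<and>
         Factorial_Ring.prime (card P)"
proof -
  define H where "H = hughes_set G (prime_divisors_group G)"
  have H: "H \<lhd> G"
    unfolding H_def by (rule hughes_set_normal)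
  interpret H: normal H G
    by (rule H)
  have primes: "\<exists>s::nat. Factorial_Ring.prime s \<and> g [^] s = \<one>" if g: "g \<in> carrier G" "g \<notin> H" for g
  proof (rule ccontr)
    assume "\<not> ?thesis"
    then have "g \<in> {x \<in> carrier G. \<forall>r\<in>prime_divisors_group G. x [^] r \<noteq> \<one>}"
      using g by (auto simp: prime_divisors_group_def)
    then have "g \<in> H"
      unfolding H_def hughes_set_def by (rule generate.incl)
    then show False
      using g by blast
  qed
  have hughes_carrier: "hughes G r \<subseteq> carrier G" for r
    unfolding hughes_def by (intro generate_incl) blast
  have two: "\<exists>x \<in> carrier G - H. x [^] q \<noteq> \<one>" if q: "Factorial_Ring.prime (q::nat)" for q
  proof (cases "q \<in> prime_divisors_group G")
    case True
    show ?thesis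
    proof (rule ccontr)
      assume "\<not> ?thesis"
      \<comment> \<open>If \<open>q\<close> killed everything outside \<open>H\<close>, all
        generators of \<open>hughes G q\<close> would lie in \<open>H\<close>.\<close>
      then have "hughes G q \<subseteq> H"
        unfolding hughes_def by (intro generate_subgroup_incl H.subgroup_axioms) blast
      then show False
        using proper[OF True] H_def by blast
    qed
  next
    case False
    \<comment> \<open>When \<open>q\<close> does not divide the order, it kills only the identity,
      so any element outside \<open>H\<close> serves; the containment for some prime divisor of the
      order provides one.\<close>
    then have "coprime q (order G)"
      using q by (simp add: prime_divisors_group_def prime_imp_coprime)
    then have q_free: "x = \<one>" if "x \<in> carrier G" "x [^] q = \<one>" for x
      using mem_subgroup_if_coprime_pows[OF triv_subgroup that(1), of q "order G"]
        that pow_order_eq_1[OF that(1)] by simp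
    have "order G \<noteq> 1"
      using nontriv H.subset order_one_triv_iff unfolding H_def by blast
    then obtain p where "Factorial_Ring.prime p" "p dvd order G"
      using prime_factor_nat by blast
    then have "p \<in> prime_divisors_group G"
      by (simp add: prime_divisors_group_def)
    then have "\<exists>x. x \<in> carrier G \<and> x \<notin> H"
      using proper[of p] hughes_carrier[of p] unfolding H_def by blast
    then show ?thesis
      using q_free H.one_closed by blast
  qed
  obtain F x p q where F: "F \<lhd> G" "H \<subset> F" and p: "Factorial_Ring.prime (p::nat)"
    and q: "Factorial_Ring.prime (q::nat)" and pq: "p \<noteq> q"
    and F_pows: "\<And>f. f \<in> F \<Longrightarrow> \<exists>n. f [^] (q ^ n) = \<one>" and x: "x \<in> carrier G" "x \<notin> F"
      "F <#> generate G {x} = carrier G" and outside: "\<And>g. g \<in> carrier G \<Longrightarrow> g \<notin> F \<Longrightarrow> g [^] p = \<one>"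
    using frobenius_kernel_splitting[OF fin sol H primes two] by metis
  define P where "P = generate G {x}"
  interpret F: normal F G
    by (rule F)
  have F1: "F \<noteq> {\<one>}"
    using F(2) H.one_closed by blast
  have frob: "frobenius_group G F P" and card_P: "card P = p"
    using frobenius_group_of_splitting[OF fin F(1) F1 p q pq F_pows x outside]
    unfolding P_def by blast+
  interpret FG: group "G\<lparr>carrier := F\<rparr>"
    by (rule subgroup_imp_group[OF F.subgroup_axioms])
  have "\<exists>m. order (G\<lparr>carrier := F\<rparr>) = q ^ m"
  proof (rule FG.order_eq_prime_power[OF _ q])
    show "finite (carrier (G\<lparr>carrier := F\<rparr>))"
      using fin F.subset finite_subset by auto
    show "\<exists>n. f [^]\<^bsub>G\<lparr>carrier := F\<rparr>\<^esub> (q ^ n) = \<one>\<^bsub>G\<lparr>carrier := F\<rparr>\<^esub>"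
      if "f \<in> carrier (G\<lparr>carrier := F\<rparr>)" for f
      using F_pows[of f] that by (simp add: nat_pow_consistent[symmetric])
  qed blast
  then have pgroup: "finite_p_group q (G\<lparr>carrier := F\<rparr>)"
    using FG.is_group by (simp add: finite_p_group_def)
  have hughes_F: "hughes (G\<lparr>carrier := F\<rparr>) q = H"
    using frobenius_prime_complement(2)[OF fin frob q pgroup F1] card_P p by (simp add: H_def)
  moreover have "\<not> comm_group (G\<lparr>carrier := F\<rparr>)"
  proof
    assume "comm_group (G\<lparr>carrier := F\<rparr>)"
    then interpret FG: comm_group "G\<lparr>carrier := F\<rparr>" .
    show False
      using FG.hughes_trivial_or_whole[of q] hughes_F F(2) nontriv by (auto simp: H_def)
  qed
  ultimately show ?thesis
    using frob q pgroup F(2) nontriv p card_P H_def by metis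
qed

theorem theorem1:
  fixes G :: "('a, 'b) monoid_scheme" (structure)
  assumes "group G" and "finite (carrier G)" and "solvable G"
  defines "\<pi> \<equiv> prime_divisors_group G"
  shows
    "(({\<one>} \<subset> hughes_set G \<pi> \<and> (\<forall>p\<in>\<pi>. hughes_set G \<pi> \<subset> hughes G p)) \<longleftrightarrow>
      (\<exists>F H q. frobenius_group G F H \<and> Factorial_Ring.prime q \<and>
         finite_p_group q (G\<lparr>carrier := F\<rparr>) \<and> \<not> comm_group (G\<lparr>carrier := F\<rparr>) \<and>
         {\<one>} \<subset> hughes (G\<lparr>carrier := F\<rparr>) q \<and> hughes (G\<lparr>carrier := F\<rparr>) q \<subset> F \<and>
         Factorial_Ring.prime (card H))) \<and>
     (\<forall>F H q. frobenius_group G F H \<and> Factorial_Ring.prime q \<and>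
         finite_p_group q (G\<lparr>carrier := F\<rparr>) \<and> \<not> comm_group (G\<lparr>carrier := F\<rparr>) \<and>
         {\<one>} \<subset> hughes (G\<lparr>carrier := F\<rparr>) q \<and> hughes (G\<lparr>carrier := F\<rparr>) q \<subset> F \<and>
         Factorial_Ring.prime (card H) \<longrightarrow>
       hughes_set G \<pi> = hughes (G\<lparr>carrier := F\<rparr>) q)"
proof -
  interpret group G
    by fact
  note fin = \<open>finite (carrier G)\<close>
  \<comment> \<open>One claim covers both the backward implication and the final identification of
    the Hughes subgroups.\<close>
  have frobenius: "hughes_set G \<pi> = hughes (G\<lparr>carrier := F\<rparr>) q \<and>
      (\<forall>p\<in>\<pi>. hughes_set G \<pi> \<subset> hughes G p)"
    if "frobenius_group G F H" "Factorial_Ring.prime q" "finite_p_group q (G\<lparr>carrier := F\<rparr>)"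
      "{\<one>} \<subset> hughes (G\<lparr>carrier := F\<rparr>) q" "hughes (G\<lparr>carrier := F\<rparr>) q \<subset> F"
      "Factorial_Ring.prime (card H)" for F H q
  proof -
    have "F \<noteq> {\<one>}"
      using that(4,5) by blast
    then show ?thesis
      unfolding \<pi>_def
      using frobenius_prime_complement(2,3)[OF fin that(1-3) _ that(6)] that(5) by metis
  qed
  show ?thesis
  proof (intro conjI iffI allI impI ballI)
    assume "{\<one>} \<subset> hughes_set G \<pi> \<and> (\<forall>p\<in>\<pi>. hughes_set G \<pi> \<subset> hughes G p)"
    then show "\<exists>F H q. frobenius_group G F H \<and> Factorial_Ring.prime q \<and>
         finite_p_group q (G\<lparr>carrier := F\<rparr>) \<and> \<not> comm_group (G\<lparr>carrier := F\<rparr>) \<and>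
         {\<one>} \<subset> hughes (G\<lparr>carrier := F\<rparr>) q \<and> hughes (G\<lparr>carrier := F\<rparr>) q \<subset> F \<and>
         Factorial_Ring.prime (card H)"
      unfolding \<pi>_def by (intro frobenius_if_hughes_set_proper fin \<open>solvable G\<close>) blast+
  next
    assume "\<exists>F H q. frobenius_group G F H \<and> Factorial_Ring.prime q \<and>
         finite_p_group q (G\<lparr>carrier := F\<rparr>) \<and> \<not> comm_group (G\<lparr>carrier := F\<rparr>) \<and>
         {\<one>} \<subset> hughes (G\<lparr>carrier := F\<rparr>) q \<and> hughes (G\<lparr>carrier := F\<rparr>) q \<subset> F \<and>
         Factorial_Ring.prime (card H)"
    then obtain F H q where FHq: "frobenius_group G F H" "Factorial_Ring.prime q"
        "finite_p_group q (G\<lparr>carrier := F\<rparr>)" "{\<one>} \<subset> hughes (G\<lparr>carrier := F\<rparr>) q"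
        "hughes (G\<lparr>carrier := F\<rparr>) q \<subset> F" "Factorial_Ring.prime (card H)"
      by blast
    show "{\<one>} \<subset> hughes_set G \<pi>"
      using frobenius[OF FHq] FHq(4) by simp
    show "hughes_set G \<pi> \<subset> hughes G p" if "p \<in> \<pi>" for p
      using frobenius[OF FHq] that by blast
  qed (use frobenius in blast)
qed

end
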